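(* Let $p\in[1,\infty]$, and let $(J_2^1(f_2^1),\dots,J_2^n(f_2^n))$ be a vector of independent (centered) quadratic Wiener functionals. Let $a=\max_{1\le i\le n}\max_k|a_k^i|$. Then $$\lim_{x\to+\infty}\frac{\log P\big(|(J_2^1(f_2^1),\dots,J_2^n(f_2^n))|_p\ge x\big)}{x}=-\frac1a.$$
   Context: For a symmetric $f_2\in L^2(\mathbb R_+^2)$ write $f_2=\frac12\sum_{k\ge0}a_k\,h_k\otimes h_k$ (convergence in $L^2(\mathbb R_+^2)$), where $(h_k)_{k\in\mathbb N}$ is an orthonormal basis of $L^2(\mathbb R_+)$ and $(a_k)_{k\in\mathbb N}$ are the (real, square-summable) associated eigenvalues. A centered quadratic Wiener functional is $J_2(f_2)=\frac12\sum_{k\ge0}a_k\big((\int_0^\infty h_k(t)\,dB_t)^2-1\big)$ (convergence in $L^2$) for a standard Brownian motion $B$. $J_2^1(f_2^1),\dots,J_2^n(f_2^n)$ are mutually independent such functionals with respect to possibly different Brownian motions, with eigenvalues $(a_k^i)_k$; they are understood to be nonzero. $|\cdot|_p$ is the $\ell^p$-norm on $\mathbb R^n$. *)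

theory Defs
  imports "HOL-Probability.Probability"
begin

definition L2_fun :: "'a measure \<Rightarrow> ('a \<Rightarrow> real) set" where
  "L2_fun M = {f \<in> borel_measurable M. integrable M (\<lambda>x. (f x)\<^sup>2)}"

definition L2_tendsto :: "'a measure \<Rightarrow> (nat \<Rightarrow> 'a \<Rightarrow> real) \<Rightarrow> ('a \<Rightarrow> real) \<Rightarrow> bool" where
  "L2_tendsto M F f \<longleftrightarrow> (\<forall>N. F N \<in> L2_fun M) \<and> f \<in> L2_fun M \<and>
     (\<lambda>N. LINT x|M. (F N x - f x)\<^sup>2) \<longlonglongrightarrow> 0"

definition half_line :: "real measure" where
  "half_line = restrict_space lborel {0..}"

definition L2_orthonormal_basis :: "'a measure \<Rightarrow> (nat \<Rightarrow> 'a \<Rightarrow> real) \<Rightarrow> bool" where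
  "L2_orthonormal_basis M h \<longleftrightarrow>
     (\<forall>k. h k \<in> L2_fun M) \<and>
     (\<forall>j k. (LINT x|M. h j x * h k x) = (if j = k then 1 else 0)) \<and>
     (\<forall>g \<in> L2_fun M. L2_tendsto M (\<lambda>N x. \<Sum>k<N. (LINT y|M. h k y * g y) * h k x) g)"

text \<open>The eigenvalues \<open>a k\<close> include the normalisation of the kernel by the factor \<open>1/2\<close>:
  \<open>f = 1/2 * (\<Sum>k. a k * h k \<otimes> h k)\<close>.\<close>

definition eigen_expansion ::
  "(real \<times> real \<Rightarrow> real) \<Rightarrow> (nat \<Rightarrow> real) \<Rightarrow> (nat \<Rightarrow> real \<Rightarrow> real) \<Rightarrow> bool" where
  "eigen_expansion f a h \<longleftrightarrow>
     f \<in> L2_fun (half_line \<Otimes>\<^sub>M half_line) \<and>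
     (AE z in half_line \<Otimes>\<^sub>M half_line. f (snd z, fst z) = f z) \<and>
     L2_orthonormal_basis half_line h \<and>
     summable (\<lambda>k. (a k)\<^sup>2) \<and>
     L2_tendsto (half_line \<Otimes>\<^sub>M half_line)
       (\<lambda>N (s, t). 1 / 2 * (\<Sum>k<N. a k * (h k s * h k t))) f"

text \<open>The values \<open>B t\<close> for \<open>t < 0\<close> are unconstrained and never used.\<close>

locale brownian_motion = prob_space M for M :: "'a measure" +
  fixes B :: "real \<Rightarrow> 'a \<Rightarrow> real"
  assumes random_variable: "0 \<le> t \<Longrightarrow> B t \<in> borel_measurable M"
    and starts_at_0: "AE \<omega> in M. B 0 \<omega> = 0"
    and gaussian_increments: "0 \<le> s \<Longrightarrow> s < t \<Longrightarrow>
      distributed M lborel (\<lambda>\<omega>. B t \<omega> - B s \<omega>) (normal_density 0 (sqrt (t - s)))"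
    and independent_increments: "0 \<le> \<tau> (0::nat) \<Longrightarrow> (\<And>i. i < m \<Longrightarrow> \<tau> i \<le> \<tau> (Suc i)) \<Longrightarrow>
      indep_vars (\<lambda>_. borel) (\<lambda>i \<omega>. B (\<tau> (Suc i)) \<omega> - B (\<tau> i) \<omega>) {..<m}"
    and continuous_paths: "AE \<omega> in M. continuous_on {0..} (\<lambda>t. B t \<omega>)"

text \<open>A list of triples \<open>(c, u, v)\<close> encodes the step function that is the sum of the functions
  \<open>c * indicator {u<..v}\<close>; the intervals may overlap.\<close>

definition step_fun :: "(real \<times> real \<times> real) list \<Rightarrow> real \<Rightarrow> real" where
  "step_fun xs s = (\<Sum>(c, u, v)\<leftarrow>xs. c * indicator {u<..v} s)"

definition step_integral ::
  "(real \<Rightarrow> 'a \<Rightarrow> real) \<Rightarrow> (real \<times> real \<times> real) list \<Rightarrow> 'a \<Rightarrow> real" where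
  "step_integral B xs \<omega> = (\<Sum>(c, u, v)\<leftarrow>xs. c * (B v \<omega> - B u \<omega>))"

text \<open>The Wiener integral is determined only almost surely; the predicate says that the random
  variable \<open>X\<close> is a version of the integral of \<open>h\<close> over \<open>{0..}\<close> against \<open>B\<close>.\<close>

definition is_wiener_integral ::
  "'a measure \<Rightarrow> (real \<Rightarrow> 'a \<Rightarrow> real) \<Rightarrow> (real \<Rightarrow> real) \<Rightarrow> ('a \<Rightarrow> real) \<Rightarrow> bool" where
  "is_wiener_integral M B h X \<longleftrightarrow>
     (\<exists>xs. (\<forall>N. \<forall>(c, u, v) \<in> set (xs N). 0 \<le> u \<and> u \<le> v) \<and>
        L2_tendsto half_line (\<lambda>N. step_fun (xs N)) h \<and>
        L2_tendsto M (\<lambda>N. step_integral B (xs N)) X)"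

text \<open>\<open>J\<close> is a version of the centered quadratic Wiener functional of the kernel \<open>f\<close>,
  computed from the eigenvalues \<open>a\<close> and the eigenfunctions \<open>h\<close> of \<open>f\<close>.\<close>

definition is_quadratic_wiener_functional ::
  "'a measure \<Rightarrow> (real \<Rightarrow> 'a \<Rightarrow> real) \<Rightarrow> (real \<times> real \<Rightarrow> real) \<Rightarrow> (nat \<Rightarrow> real) \<Rightarrow>
   (nat \<Rightarrow> real \<Rightarrow> real) \<Rightarrow> ('a \<Rightarrow> real) \<Rightarrow> bool" where
  "is_quadratic_wiener_functional M B f a h J \<longleftrightarrow>
     brownian_motion M B \<and> eigen_expansion f a h \<and>
     (\<exists>W. (\<forall>k. is_wiener_integral M B (h k) (W k)) \<and>
        L2_tendsto M (\<lambda>N \<omega>. 1 / 2 * (\<Sum>k<N. a k * ((W k \<omega>)\<^sup>2 - 1))) J)"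

definition lp_norm :: "ennreal \<Rightarrow> 'i set \<Rightarrow> ('i \<Rightarrow> real) \<Rightarrow> real" where
  "lp_norm p I v =
     (if p = \<infinity> then Max ((\<lambda>i. \<bar>v i\<bar>) ` I)
      else (\<Sum>i\<in>I. \<bar>v i\<bar> powr enn2real p) powr (1 / enn2real p))"

end

theory Submission
  imports Defs "HOL-Real_Asymp.Real_Asymp"
begin

text \<open>
  Wiener integrals of step functions are Gaussian; passing to the limit in \<open>L\<^sup>2\<close>, the joint
  characteristic function shows that the integrals \<open>W k\<close> of an orthonormal basis are independent
  standard normal variables. Hence \<open>J\<close> is the \<open>L\<^sup>2\<close> limit of \<open>1/2 * (\<Sum>k<N. a k * ((W k)\<^sup>2 - 1))\<close>.

  Upper bound: since \<open>E exp (y * (W\<^sup>2 - 1) / 2) = exp (- y / 2) / sqrt (1 - y)\<close> is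
  \<open>exp (O(y\<^sup>2))\<close>, square summability of the eigenvalues and Fatou's lemma make \<open>E exp (\<theta> * \<bar>J\<bar>)\<close>
  finite whenever \<open>\<theta> * \<bar>a k\<bar>\<close> stays below a constant smaller than 1. The norm is at most the sum
  of the \<open>\<bar>J i\<bar>\<close>, so independence and Chernoff's bound give the rate \<open>\<theta>\<close> for every
  \<open>\<theta>\<close> below the reciprocal of the largest eigenvalue.

  Lower bound: the norm is at least \<open>\<bar>J i\<bar>\<close> for the index carrying the largest eigenvalue, and
  \<open>\<bar>J i\<bar>\<close> is large when the corresponding \<open>W k\<close> is large while the independent remainder is bounded.
\<close>

section \<open>Convergence in \<open>L\<^sup>2\<close>\<close>

lemma L2_fun_integrable_square: "f \<in> L2_fun M \<Longrightarrow> integrable M (\<lambda>x. (f x)\<^sup>2)"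
  by (auto simp: L2_fun_def)

lemma L2_fun_integrable_mult:
  assumes "f \<in> L2_fun M" "g \<in> L2_fun M"
  shows "integrable M (\<lambda>x. f x * g x)"
proof (rule Bochner_Integration.integrable_bound)
  show "integrable M (\<lambda>x. (f x)\<^sup>2 + (g x)\<^sup>2)"
    using assms by (auto simp: L2_fun_def)
  have "\<bar>u * v\<bar> \<le> u\<^sup>2 + v\<^sup>2" for u v :: real
  proof -
    have "2 * (\<bar>u\<bar> * \<bar>v\<bar>) \<le> u\<^sup>2 + v\<^sup>2"
      using sum_squares_bound[of "\<bar>u\<bar>" "\<bar>v\<bar>"] by simp
    moreover have "0 \<le> \<bar>u\<bar> * \<bar>v\<bar>" by simp
    ultimately show ?thesis unfolding abs_mult by linarith
  qed
  then show "AE x in M. norm (f x * g x) \<le> norm ((f x)\<^sup>2 + (g x)\<^sup>2)"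
    by auto
qed (use assms in \<open>auto simp: L2_fun_def\<close>)

lemma L2_fun_add:
  assumes "f \<in> L2_fun M" "g \<in> L2_fun M"
  shows "(\<lambda>x. f x + g x) \<in> L2_fun M"
  using assms L2_fun_integrable_mult[OF assms]
  by (auto simp: L2_fun_def power2_sum mult.assoc)

lemma L2_fun_cmult:
  assumes "f \<in> L2_fun M"
  shows "(\<lambda>x. c * f x) \<in> L2_fun M"
  using assms by (auto simp: L2_fun_def power_mult_distrib)

lemma L2_fun_diff:
  assumes "f \<in> L2_fun M" "g \<in> L2_fun M"
  shows "(\<lambda>x. f x - g x) \<in> L2_fun M"
  using L2_fun_add[OF assms(1) L2_fun_cmult[OF assms(2), of "-1"]] by simp

text \<open>The integral of the square of \<open>f - t * g\<close> is a quadratic polynomial in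
  \<open>t\<close> that is nonnegative for every real \<open>t\<close>, which bounds its
  discriminant.\<close>

lemma L2_Cauchy_Schwarz:
  assumes "f \<in> L2_fun M" "g \<in> L2_fun M"
  shows "\<bar>LINT x|M. f x * g x\<bar> \<le> sqrt (LINT x|M. (f x)\<^sup>2) * sqrt (LINT x|M. (g x)\<^sup>2)"
proof -
  define A where "A = (LINT x|M. (f x)\<^sup>2)"
  define B where "B = (LINT x|M. f x * g x)"
  define C where "C = (LINT x|M. (g x)\<^sup>2)"
  have nonneg: "A \<ge> 0" "C \<ge> 0" unfolding A_def C_def by simp_all
  have quad: "0 \<le> A - 2 * t * B + t\<^sup>2 * C" for t
  proof -
    have "0 \<le> (LINT x|M. (f x - t * g x)\<^sup>2)" by simp
    also have "\<dots> = (LINT x|M. (f x)\<^sup>2 - (2 * t) * (f x * g x) + t\<^sup>2 * (g x)\<^sup>2)"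
      by (intro Bochner_Integration.integral_cong) (auto simp: power2_eq_square algebra_simps)
    also have "\<dots> = A - 2 * t * B + t\<^sup>2 * C"
      using assms L2_fun_integrable_mult[OF assms] by (simp add: A_def B_def C_def L2_fun_def)
    finally show ?thesis .
  qed
  have "B\<^sup>2 \<le> A * C"
  proof (cases "C = 0")
    case True
    have "B = 0"
    proof (rule ccontr)
      assume "B \<noteq> 0"
      \<comment> \<open>With \<open>C = 0\<close> the polynomial is affine in \<open>t\<close>; this
        value of \<open>t\<close> makes it equal to -1.\<close>
      then show False using quad[of "(A + 1) / (2 * B)"] True by (simp add: field_simps)
    qed
    then show ?thesis using nonneg by simp
  next
    case False
    \<comment> \<open>\<open>B / C\<close> minimises the quadratic, so evaluating there loses
      nothing.\<close>
    then show ?thesis using quad[of "B / C"] nonneg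
      by (simp add: field_simps power2_eq_square)
  qed
  then have "\<bar>B\<bar> \<le> sqrt (A * C)"
    using real_le_rsqrt[of "\<bar>B\<bar>" "A * C"] by simp
  then show ?thesis by (simp add: A_def B_def C_def real_sqrt_mult)
qed

text \<open>The bound (u + v)^2 \<le> 2 u^2 + 2 v^2 takes the place of Minkowski's inequality, so
  that no norm has to be introduced.\<close>

lemma L2_tendsto_add:
  assumes "L2_tendsto M F f" "L2_tendsto M G g"
  shows "L2_tendsto M (\<lambda>N x. F N x + G N x) (\<lambda>x. f x + g x)"
  unfolding L2_tendsto_def
proof (intro conjI allI)
  have F: "F N \<in> L2_fun M" "f \<in> L2_fun M" "(\<lambda>N. LINT x|M. (F N x - f x)\<^sup>2) \<longlonglongrightarrow> 0"
    and G: "G N \<in> L2_fun M" "g \<in> L2_fun M" "(\<lambda>N. LINT x|M. (G N x - g x)\<^sup>2) \<longlonglongrightarrow> 0" for N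
    using assms by (auto simp: L2_tendsto_def)
  show "(\<lambda>x. F N x + G N x) \<in> L2_fun M" "(\<lambda>x. f x + g x) \<in> L2_fun M" for N
    using F G by (auto intro: L2_fun_add)
  show "(\<lambda>N. LINT x|M. (F N x + G N x - (f x + g x))\<^sup>2) \<longlonglongrightarrow> 0"
  proof (rule tendsto_sandwich[OF _ _ tendsto_const])
    show "\<forall>\<^sub>F N in sequentially. (LINT x|M. (F N x + G N x - (f x + g x))\<^sup>2)
      \<le> 2 * (LINT x|M. (F N x - f x)\<^sup>2) + 2 * (LINT x|M. (G N x - g x)\<^sup>2)"
    proof (rule always_eventually, rule allI)
      fix N
      have d: "(\<lambda>x. F N x - f x) \<in> L2_fun M" "(\<lambda>x. G N x - g x) \<in> L2_fun M"
        using F G by (auto intro: L2_fun_diff)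
      have "(LINT x|M. (F N x + G N x - (f x + g x))\<^sup>2)
          \<le> (LINT x|M. 2 * (F N x - f x)\<^sup>2 + 2 * (G N x - g x)\<^sup>2)"
      proof (rule integral_mono)
        have "(\<lambda>x. F N x + G N x - (f x + g x)) \<in> L2_fun M"
          using L2_fun_add[OF d] by (simp add: algebra_simps)
        then show "integrable M (\<lambda>x. (F N x + G N x - (f x + g x))\<^sup>2)"
          by (rule L2_fun_integrable_square)
        show "integrable M (\<lambda>x. 2 * (F N x - f x)\<^sup>2 + 2 * (G N x - g x)\<^sup>2)"
          using d by (auto simp: L2_fun_def)
        fix x
        have "(u + v)\<^sup>2 \<le> 2 * u\<^sup>2 + 2 * v\<^sup>2" for u v :: real
          using sum_squares_bound[of u v] by (simp add: power2_sum)
        from this[of "F N x - f x" "G N x - g x"]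
        show "(F N x + G N x - (f x + g x))\<^sup>2 \<le> 2 * (F N x - f x)\<^sup>2 + 2 * (G N x - g x)\<^sup>2"
          by (simp add: algebra_simps)
      qed
      also have "\<dots> = 2 * (LINT x|M. (F N x - f x)\<^sup>2) + 2 * (LINT x|M. (G N x - g x)\<^sup>2)"
        using d by (simp add: L2_fun_def)
      finally show "(LINT x|M. (F N x + G N x - (f x + g x))\<^sup>2)
        \<le> 2 * (LINT x|M. (F N x - f x)\<^sup>2) + 2 * (LINT x|M. (G N x - g x)\<^sup>2)" .
    qed
    show "(\<lambda>N. 2 * (LINT x|M. (F N x - f x)\<^sup>2) + 2 * (LINT x|M. (G N x - g x)\<^sup>2)) \<longlonglongrightarrow> 0"
      using tendsto_add[OF tendsto_mult_right_zero[OF F(3)] tendsto_mult_right_zero[OF G(3)]]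
      by simp
  qed auto
qed

lemma L2_tendsto_cmult:
  assumes "L2_tendsto M F f"
  shows "L2_tendsto M (\<lambda>N x. c * F N x) (\<lambda>x. c * f x)"
proof -
  have "(c * u - c * v)\<^sup>2 = c\<^sup>2 * (u - v)\<^sup>2" for u v :: real
    by (simp add: power_mult_distrib flip: right_diff_distrib)
  then show ?thesis
    using assms tendsto_mult_right_zero[of _ sequentially "c\<^sup>2"]
    by (auto simp: L2_tendsto_def L2_fun_cmult)
qed

lemma L2_tendsto_const: "f \<in> L2_fun M \<Longrightarrow> L2_tendsto M (\<lambda>N. f) f"
  by (simp add: L2_tendsto_def)

text \<open>Write \<open>F N\<close> as \<open>f\<close> plus an error and expand the square: the
  cross term \<open>b N\<close> tends to 0 by Cauchy-Schwarz. This carries variances of step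
  integrals, and later second moments of remainders, to the limit.\<close>

lemma L2_tendsto_square_integral:
  assumes "L2_tendsto M F f"
  shows "(\<lambda>N. LINT x|M. (F N x)\<^sup>2) \<longlonglongrightarrow> (LINT x|M. (f x)\<^sup>2)"
proof -
  have F: "F N \<in> L2_fun M" and f: "f \<in> L2_fun M"
    and lim: "(\<lambda>N. LINT x|M. (F N x - f x)\<^sup>2) \<longlonglongrightarrow> 0" for N
    using assms by (auto simp: L2_tendsto_def)
  define b where "b N = (LINT x|M. f x * (F N x - f x))" for N
  have "b \<longlonglongrightarrow> 0"
  proof (rule Lim_null_comparison)
    show "\<forall>\<^sub>F N in sequentially.
      norm (b N) \<le> sqrt (LINT x|M. (f x)\<^sup>2) * sqrt (LINT x|M. (F N x - f x)\<^sup>2)"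
      unfolding b_def real_norm_def
      by (intro always_eventually allI L2_Cauchy_Schwarz f L2_fun_diff F)
    show "(\<lambda>N. sqrt (LINT x|M. (f x)\<^sup>2) * sqrt (LINT x|M. (F N x - f x)\<^sup>2)) \<longlonglongrightarrow> 0"
      using tendsto_real_sqrt[OF lim] by (intro tendsto_mult_right_zero) simp
  qed
  have "(LINT x|M. (F N x)\<^sup>2) = (LINT x|M. (f x)\<^sup>2) + 2 * b N + (LINT x|M. (F N x - f x)\<^sup>2)" for N
  proof -
    have d: "(\<lambda>x. F N x - f x) \<in> L2_fun M" using F f by (rule L2_fun_diff)
    have "(LINT x|M. (F N x)\<^sup>2) =
        (LINT x|M. (f x)\<^sup>2 + 2 * (f x * (F N x - f x)) + (F N x - f x)\<^sup>2)"
      by (intro Bochner_Integration.integral_cong) (auto simp: power2_eq_square algebra_simps)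
    also have "\<dots> = (LINT x|M. (f x)\<^sup>2) + 2 * b N + (LINT x|M. (F N x - f x)\<^sup>2)"
      using f d L2_fun_integrable_mult[OF f d] by (simp add: b_def L2_fun_def)
    finally show ?thesis .
  qed
  moreover have "(\<lambda>N. (LINT x|M. (f x)\<^sup>2) + 2 * b N + (LINT x|M. (F N x - f x)\<^sup>2))
    \<longlonglongrightarrow> (LINT x|M. (f x)\<^sup>2) + 2 * 0 + 0"
    by (intro tendsto_intros lim \<open>b \<longlonglongrightarrow> 0\<close>)
  ultimately show ?thesis by simp
qed

lemma (in finite_measure) L2_fun_const: "(\<lambda>_. c) \<in> L2_fun M"
  by (simp add: L2_fun_def)

text \<open>Cauchy-Schwarz against the constant 1, whose norm is 1 on a probability space.\<close>

lemma (in prob_space) L2_tendsto_L1: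
  assumes "L2_tendsto M F f"
  shows "(\<lambda>N. LINT x|M. \<bar>F N x - f x\<bar>) \<longlonglongrightarrow> 0"
proof (rule Lim_null_comparison)
  have F: "F N \<in> L2_fun M" and f: "f \<in> L2_fun M"
    and lim: "(\<lambda>N. LINT x|M. (F N x - f x)\<^sup>2) \<longlonglongrightarrow> 0" for N
    using assms by (auto simp: L2_tendsto_def)
  show "\<forall>\<^sub>F N in sequentially.
    norm (LINT x|M. \<bar>F N x - f x\<bar>) \<le> sqrt (LINT x|M. (F N x - f x)\<^sup>2)"
  proof (rule always_eventually, rule allI)
    fix N
    have "(\<lambda>x. \<bar>F N x - f x\<bar>) \<in> L2_fun M"
      using L2_fun_diff[OF F f, of N] by (auto simp: L2_fun_def)
    from L2_Cauchy_Schwarz[OF this L2_fun_const[of 1]]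
    show "norm (LINT x|M. \<bar>F N x - f x\<bar>) \<le> sqrt (LINT x|M. (F N x - f x)\<^sup>2)"
      by (simp add: prob_space)
  qed
  show "(\<lambda>N. sqrt (LINT x|M. (F N x - f x)\<^sup>2)) \<longlonglongrightarrow> 0"
    using tendsto_real_sqrt[OF lim] by simp
qed

section \<open>Characteristic functions of Wiener integrals\<close>

text \<open>The cut-off by \<open>of_bool\<close> keeps the index range \<open>{..<m}\<close> the
  same for all intervals, so that several intervals can later be added coefficient by
  coefficient.\<close>

lemma telescope_increments:
  fixes \<tau> :: "nat \<Rightarrow> 'b" and g :: "'b \<Rightarrow> real"
  assumes "p \<le> q" "q \<le> m"
  shows "(\<Sum>i<m. of_bool (p \<le> i \<and> i < q) * (g (\<tau> (Suc i)) - g (\<tau> i))) = g (\<tau> q) - g (\<tau> p)"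
proof -
  have "(\<Sum>i<m. of_bool (p \<le> i \<and> i < q) * (g (\<tau> (Suc i)) - g (\<tau> i)))
      = (\<Sum>i\<in>{p..<q}. g (\<tau> (Suc i)) - g (\<tau> i))"
    using assms by (intro sum.mono_neutral_cong_right) auto
  also have "\<dots> = g (\<tau> q) - g (\<tau> p)"
    using assms(1) by (rule sum_Suc_diff')
  finally show ?thesis .
qed

text \<open>The order of the quantifiers is the point: the coefficients \<open>d\<close> are fixed
  before \<open>g\<close>, hence the same \<open>d\<close> describe the step function and its
  integral along every Brownian path.\<close>

lemma step_list_refinement:
  fixes xs :: "(real \<times> real \<times> real) list" and \<tau> :: "nat \<Rightarrow> real"
  assumes "\<forall>(c, u, v) \<in> set xs. \<exists>p q. p \<le> q \<and> q \<le> m \<and> u = \<tau> p \<and> v = \<tau> q"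
  shows "\<exists>d. \<forall>g::real \<Rightarrow> real.
    (\<Sum>(c, u, v)\<leftarrow>xs. c * (g v - g u)) = (\<Sum>i<m. d i * (g (\<tau> (Suc i)) - g (\<tau> i)))"
  using assms
proof (induction xs)
  case Nil
  show ?case by (intro exI[of _ "\<lambda>_. 0"]) simp
next
  case (Cons x xs)
  obtain c u v where x: "x = (c, u, v)" by (cases x)
  from Cons.prems x obtain p q where pq: "p \<le> q" "q \<le> m" "u = \<tau> p" "v = \<tau> q" by auto
  from Cons.IH Cons.prems obtain d where d:
    "\<And>g. (\<Sum>(c, u, v)\<leftarrow>xs. c * (g v - g u)) = (\<Sum>i<m. d i * (g (\<tau> (Suc i)) - g (\<tau> i)))"
    by auto
  have "(\<Sum>(c, u, v)\<leftarrow>x # xs. c * (g v - g u)) =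
      (\<Sum>i<m. (c * of_bool (p \<le> i \<and> i < q) + d i) * (g (\<tau> (Suc i)) - g (\<tau> i)))" for g
    unfolding distrib_right sum.distrib mult.assoc
    unfolding sum_distrib_left[symmetric] telescope_increments[OF pq(1,2)]
    using d[of g] by (simp add: x pq)
  then show ?case by (intro exI[of _ "\<lambda>i. c * of_bool (p \<le> i \<and> i < q) + d i"]) blast
qed

text \<open>A step function is the step integral against \<open>t \<mapsto> indicator {..t} s\<close>, so one refinement serves both.\<close>

lemma step_fun_eq_increments:
  assumes "\<forall>(c, u, v) \<in> set xs. u \<le> v"
  shows "step_fun xs s = (\<Sum>(c, u, v)\<leftarrow>xs. c * (indicator {..v} s - indicator {..u} s))"
  unfolding step_fun_def
  using assms by (intro arg_cong[where f = sum_list] map_cong) (auto simp: indicator_def)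

lemma integral_half_line_Ioc:
  assumes "0 \<le> u" "u \<le> v"
  shows "has_bochner_integral half_line (indicator {u<..v} :: real \<Rightarrow> real) (v - u)"
proof -
  have "emeasure half_line {u<..v} = emeasure lborel {u<..v}"
    unfolding half_line_def using assms by (intro emeasure_restrict_space) auto
  then have "measure half_line {u<..v} = v - u" "emeasure half_line {u<..v} < \<infinity>"
    using assms by (auto simp: measure_def)
  moreover have "{u<..v} \<in> sets half_line"
    unfolding half_line_def using assms by (auto simp: sets_restrict_space_iff)
  ultimately show ?thesis
    using has_bochner_integral_real_indicator[of "{u<..v}" half_line] by simp
qed

text \<open>The cells of the grid are pairwise disjoint, so all mixed products vanish. The value is
  the variance of the corresponding sum of Brownian increments.\<close>

lemma integral_step_square:
  fixes \<tau> :: "nat \<Rightarrow> real"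
  assumes "0 \<le> \<tau> 0" and mono: "\<And>i. i < m \<Longrightarrow> \<tau> i \<le> \<tau> (Suc i)"
  shows "(LINT s|half_line. (\<Sum>i<m. d i * indicator {\<tau> i<..\<tau> (Suc i)} s)\<^sup>2)
       = (\<Sum>i<m. (d i)\<^sup>2 * (\<tau> (Suc i) - \<tau> i))"
proof -
  have mono': "\<tau> i \<le> \<tau> j" if "i \<le> j" "j \<le> m" for i j
    using that
  proof (induction rule: dec_induct)
    case (step n)
    then show ?case using mono[of n] by simp
  qed simp
  have sq: "(\<Sum>i<m. d i * indicator {\<tau> i<..\<tau> (Suc i)} s)\<^sup>2 =
      (\<Sum>i<m. (d i)\<^sup>2 * indicator {\<tau> i<..\<tau> (Suc i)} s)" for s :: real
  proof -
    let ?e = "\<lambda>i. indicator {\<tau> i<..\<tau> (Suc i)} s :: real"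
    have disj: "?e i * ?e j = 0" if "i < j" "j < m" for i j
      using mono'[of "Suc i" j] that by (auto simp: indicator_def)
    have e: "?e i * ?e j = (if i = j then ?e i else 0)" if "i < m" "j < m" for i j
      using disj[of i j] disj[of j i] that
      by (cases i j rule: linorder_cases) (auto simp: indicator_def)
    have "(\<Sum>i<m. d i * ?e i)\<^sup>2 = (\<Sum>i<m. \<Sum>j<m. d i * d j * (?e i * ?e j))"
      unfolding power2_eq_square sum_product by (simp only: mult_ac)
    also have "\<dots> = (\<Sum>i<m. \<Sum>j<m. if i = j then (d i)\<^sup>2 * ?e i else 0)"
      by (intro sum.cong refl) (auto simp: e power2_eq_square)
    also have "\<dots> = (\<Sum>i<m. (d i)\<^sup>2 * ?e i)" by simp
    finally show ?thesis .
  qed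
  have "has_bochner_integral half_line (\<lambda>s. \<Sum>i<m. (d i)\<^sup>2 * indicator {\<tau> i<..\<tau> (Suc i)} s)
      (\<Sum>i<m. (d i)\<^sup>2 * (\<tau> (Suc i) - \<tau> i))"
  proof (intro has_bochner_integral_sum has_bochner_integral_mult_right integral_half_line_Ioc)
    fix i assume "i \<in> {..<m}"
    then show "0 \<le> \<tau> i" "\<tau> i \<le> \<tau> (Suc i)" using mono'[of 0 i] assms by auto
  qed
  then show ?thesis unfolding sq by (rule has_bochner_integral_integral_eq)
qed

section \<open>Characteristic functions of step integrals\<close>

context brownian_motion
begin

lemma char_increment:
  assumes "0 \<le> s" "s \<le> t"
  shows "(CLINT \<omega>|M. iexp (c * (B t \<omega> - B s \<omega>))) = of_real (exp (- (c\<^sup>2 * (t - s)) / 2))"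
proof (cases "s = t")
  \<comment> \<open>The Gaussian law of increments is given only for \<open>s < t\<close>; the
    degenerate increment is 0 and both sides are 1.\<close>
  case True
  then show ?thesis by (simp add: prob_space)
next
  case False
  with assms have st: "s < t" by simp
  have [measurable]: "B t \<in> borel_measurable M" "B s \<in> borel_measurable M"
    using assms by (auto intro: random_variable)
  let ?Y = "\<lambda>\<omega>. (B t \<omega> - B s \<omega>) / sqrt (t - s)"
  have "distributed M lborel ?Y std_normal_density"
    using normal_standard_normal_convert[of "sqrt (t - s)" "\<lambda>\<omega>. B t \<omega> - B s \<omega>" 0]
      gaussian_increments[OF assms(1) st] st by simp
  then have Y: "distr M lborel ?Y = std_normal_distribution"
    by (rule distributed_distr_eq_density)
  have "(CLINT \<omega>|M. iexp (c * (B t \<omega> - B s \<omega>))) = (CLINT \<omega>|M. iexp ((c * sqrt (t - s)) * ?Y \<omega>))"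
    using st by (intro Bochner_Integration.integral_cong) auto
  also have "\<dots> = char (distr M lborel ?Y) (c * sqrt (t - s))"
    unfolding char_def by (subst integral_distr) auto
  also have "\<dots> = of_real (exp (- (c\<^sup>2 * (t - s)) / 2))"
    unfolding Y char_std_normal_distribution using st by (simp add: power_mult_distrib)
  finally show ?thesis .
qed

lemma char_increments_sum:
  assumes "0 \<le> \<tau> (0::nat)" and mono: "\<And>i. i < m \<Longrightarrow> \<tau> i \<le> \<tau> (Suc i)"
  shows "(CLINT \<omega>|M. iexp (\<Sum>i<m. d i * (B (\<tau> (Suc i)) \<omega> - B (\<tau> i) \<omega>)))
    = of_real (exp (- (\<Sum>i<m. (d i)\<^sup>2 * (\<tau> (Suc i) - \<tau> i)) / 2))"
proof -
  have \<tau>_nonneg: "0 \<le> \<tau> i" if "i \<le> m" for i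
    using that assms by (induction i) (auto intro: order_trans)
  define X where "X i \<omega> = d i * (B (\<tau> (Suc i)) \<omega> - B (\<tau> i) \<omega>)" for i \<omega>
  have X: "X i \<in> borel_measurable M" if "i < m" for i
    unfolding X_def using that by (intro borel_measurable_times borel_measurable_diff borel_measurable_const
      random_variable \<tau>_nonneg) auto
  have "indep_vars (\<lambda>_. borel) X {..<m}"
    using indep_vars_compose2[OF independent_increments[OF assms], of m "\<lambda>i x. d i * x" "\<lambda>_. borel"]
    by (simp add: X_def[abs_def])
  \<comment> \<open>Evaluation at 1 is enough, because the coefficients \<open>d i\<close> are
    already part of the summands \<open>X i\<close>.\<close>
  then have "char (distr M borel (\<lambda>\<omega>. \<Sum>i<m. X i \<omega>)) 1 = (\<Prod>i<m. char (distr M borel (X i)) 1)"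
    by (rule char_distr_sum)
  also have "\<dots> = (\<Prod>i<m. of_real (exp (- ((d i)\<^sup>2 * (\<tau> (Suc i) - \<tau> i)) / 2)))"
  proof (rule prod.cong[OF refl])
    fix i assume i: "i \<in> {..<m}"
    then show "char (distr M borel (X i)) 1 = of_real (exp (- ((d i)\<^sup>2 * (\<tau> (Suc i) - \<tau> i)) / 2))"
      using char_increment[of "\<tau> i" "\<tau> (Suc i)" "d i"] X[of i] \<tau>_nonneg[of i] mono[of i]
      unfolding char_def by (subst integral_distr) (auto simp: X_def)
  qed
  also have "\<dots> = of_real (exp (- (\<Sum>i<m. (d i)\<^sup>2 * (\<tau> (Suc i) - \<tau> i)) / 2))"
    by (simp add: exp_sum[symmetric] sum_divide_distrib sum_negf del: of_real_exp flip: of_real_prod)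
  finally have "char (distr M borel (\<lambda>\<omega>. \<Sum>i<m. X i \<omega>)) 1
    = of_real (exp (- (\<Sum>i<m. (d i)\<^sup>2 * (\<tau> (Suc i) - \<tau> i)) / 2))" .
  moreover have "(\<lambda>\<omega>. \<Sum>i<m. X i \<omega>) \<in> borel_measurable M"
    using X by (intro borel_measurable_sum) auto
  ultimately show ?thesis
    unfolding char_def by (subst (asm) integral_distr) (auto simp: X_def)
qed

text \<open>The intervals in the list may overlap, so their increments need not be independent.
  Passing to the grid of all endpoints restores independence and turns the variance into the squared
  norm of the step function.\<close>

lemma char_step_integral:
  assumes xs: "\<forall>(c, u, v) \<in> set xs. 0 \<le> u \<and> u \<le> v"
  shows "(CLINT \<omega>|M. iexp (step_integral B xs \<omega>))
    = of_real (exp (- (LINT s|half_line. (step_fun xs s)\<^sup>2) / 2))"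
proof -
  \<comment> \<open>Inserting 0 keeps the grid nonempty even for the empty list, so that its first
    point exists.\<close>
  define T where "T = insert 0 (\<Union>(c, u, v) \<in> set xs. {u, v})"
  define L where "L = sorted_list_of_set T"
  define m where "m = length L - 1"
  have "finite T" by (auto simp: T_def split: prod.split)
  then have L: "set L = T" "sorted L" by (auto simp: L_def)
  have "L \<noteq> []" using L(1) by (auto simp: T_def)
  define \<tau> where "\<tau> i = L ! i" for i
  have mono: "\<tau> i \<le> \<tau> (Suc i)" if "i < m" for i
    using that L(2) by (auto simp: \<tau>_def m_def sorted_iff_nth_mono)
  have "\<tau> 0 \<in> T" using L(1) \<open>L \<noteq> []\<close> by (auto simp: \<tau>_def)
  then have \<tau>0: "0 \<le> \<tau> 0" using xs by (auto simp: T_def)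
  have ex: "\<exists>p\<le>m. t = \<tau> p" if "t \<in> T" for t
  proof -
    from that L(1) obtain p where "p < length L" "L ! p = t" by (metis in_set_conv_nth)
    then show ?thesis by (intro exI[of _ p]) (auto simp: \<tau>_def m_def)
  qed
  have "\<forall>(c, u, v) \<in> set xs. \<exists>p q. p \<le> q \<and> q \<le> m \<and> u = \<tau> p \<and> v = \<tau> q"
  proof safe
    fix c u v assume *: "(c, u, v) \<in> set xs"
    then have "u \<in> T" "v \<in> T" "u \<le> v" using xs by (auto simp: T_def intro!: bexI[of _ "(c,u,v)"])
    with ex obtain p q where pq: "p \<le> m" "u = \<tau> p" "q \<le> m" "v = \<tau> q" by metis
    show "\<exists>p q. p \<le> q \<and> q \<le> m \<and> u = \<tau> p \<and> v = \<tau> q"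
    proof (cases "p \<le> q")
      \<comment> \<open>Indices in the wrong order force \<open>u = v\<close>, since the grid is
        sorted and \<open>u \<le> v\<close>; the index \<open>q\<close> then serves for both
        endpoints.\<close>
      case False
      have "q < length L" "p < length L"
        using pq(1,3) \<open>L \<noteq> []\<close> unfolding m_def by (cases L, simp, simp)+
      with False L(2) have "\<tau> q \<le> \<tau> p"
        unfolding \<tau>_def by (intro sorted_nth_mono) auto
      with pq \<open>u \<le> v\<close> have "u = v" by simp
      with pq show ?thesis by (intro exI[of _ q]) auto
    qed (use pq in blast)
  qed
  from step_list_refinement[OF this] obtain d where d:
    "\<And>g::real \<Rightarrow> real. (\<Sum>(c, u, v)\<leftarrow>xs. c * (g v - g u)) = (\<Sum>i<m. d i * (g (\<tau> (Suc i)) - g (\<tau> i)))"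
    by blast
  have "step_integral B xs \<omega> = (\<Sum>i<m. d i * (B (\<tau> (Suc i)) \<omega> - B (\<tau> i) \<omega>))" for \<omega>
    using d[of "\<lambda>t. B t \<omega>"] by (simp add: step_integral_def)
  moreover have "step_fun xs s = (\<Sum>i<m. d i * indicator {\<tau> i<..\<tau> (Suc i)} s)" for s
  proof -
    have "step_fun xs s = (\<Sum>i<m. d i * (indicator {..\<tau> (Suc i)} s - indicator {..\<tau> i} s))"
      using d[of "\<lambda>t. indicator {..t} s"] xs by (subst step_fun_eq_increments) auto
    also have "\<dots> = (\<Sum>i<m. d i * indicator {\<tau> i<..\<tau> (Suc i)} s)"
    proof (rule sum.cong[OF refl])
      fix i assume "i \<in> {..<m}"
      then show "d i * (indicator {..\<tau> (Suc i)} s - indicator {..\<tau> i} s)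
          = d i * indicator {\<tau> i<..\<tau> (Suc i)} s"
        using mono[of i] by (auto simp: indicator_def)
    qed
    finally show ?thesis .
  qed
  ultimately show ?thesis
    using char_increments_sum[OF \<tau>0 mono, of m d] integral_step_square[OF \<tau>0 mono, of m d] by simp
qed

end

text \<open>The map \<open>iexp\<close> is Lipschitz with constant 1, so the two expectations differ
  by at most the L^1 distance of the random variables.\<close>

lemma (in prob_space) tendsto_char_L2:
  assumes "L2_tendsto M F X"
  shows "(\<lambda>N. CLINT \<omega>|M. iexp (F N \<omega>)) \<longlonglongrightarrow> (CLINT \<omega>|M. iexp (X \<omega>))"
proof -
  have F [measurable]: "F N \<in> borel_measurable M" and X [measurable]: "X \<in> borel_measurable M"
    and L2: "F N \<in> L2_fun M" "X \<in> L2_fun M" for N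
    using assms by (auto simp: L2_tendsto_def L2_fun_def)
  have int: "integrable M (\<lambda>\<omega>. iexp (F N \<omega>))" "integrable M (\<lambda>\<omega>. iexp (X \<omega>))" for N
    by (auto intro!: integrable_iexp)
  have lip: "cmod (iexp x - iexp y) \<le> \<bar>x - y\<bar>" for x y
  proof -
    have "iexp x - iexp y = iexp y * (iexp (x - y) - 1)"
      by (simp add: algebra_simps flip: exp_add)
    then show ?thesis
      using iexp_approx1[of "x - y" 0] by (simp add: norm_mult)
  qed
  show ?thesis
  proof (rule Lim_transform2[OF tendsto_const], rule Lim_null_comparison)
    show "\<forall>\<^sub>F N in sequentially. norm ((CLINT \<omega>|M. iexp (X \<omega>)) - (CLINT \<omega>|M. iexp (F N \<omega>)))
      \<le> (LINT \<omega>|M. \<bar>F N \<omega> - X \<omega>\<bar>)"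
    proof (rule always_eventually, rule allI)
      fix N
      have "norm ((CLINT \<omega>|M. iexp (X \<omega>)) - (CLINT \<omega>|M. iexp (F N \<omega>)))
          = norm (CLINT \<omega>|M. iexp (X \<omega>) - iexp (F N \<omega>))"
        using int by simp
      also have "\<dots> \<le> (LINT \<omega>|M. norm (iexp (X \<omega>) - iexp (F N \<omega>)))"
        by (rule integral_norm_bound)
      also have "\<dots> \<le> (LINT \<omega>|M. \<bar>F N \<omega> - X \<omega>\<bar>)"
      proof (rule integral_mono)
        show "integrable M (\<lambda>\<omega>. norm (iexp (X \<omega>) - iexp (F N \<omega>)))"
          using int by auto
        show "integrable M (\<lambda>\<omega>. \<bar>F N \<omega> - X \<omega>\<bar>)"
          using L2_fun_integrable_mult[OF L2_fun_diff[OF L2] L2_fun_const[of 1]] by simp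
      qed (use lip in \<open>metis abs_minus_commute\<close>)
      finally show "norm ((CLINT \<omega>|M. iexp (X \<omega>)) - (CLINT \<omega>|M. iexp (F N \<omega>)))
        \<le> (LINT \<omega>|M. \<bar>F N \<omega> - X \<omega>\<bar>)" .
    qed
  qed (rule L2_tendsto_L1[OF assms])
qed

text \<open>Two limits along one approximating sequence: the characteristic function converges
  because the integrals do in L^2 of the probability space, the variance because the step functions
  do in L^2 of the half line.\<close>

lemma (in brownian_motion) char_wiener_integral:
  assumes "is_wiener_integral M B h X"
  shows "(CLINT \<omega>|M. iexp (X \<omega>)) = of_real (exp (- (LINT s|half_line. (h s)\<^sup>2) / 2))"
proof -
  from assms obtain xs where xs: "\<And>N. \<forall>(c, u, v) \<in> set (xs N). 0 \<le> u \<and> u \<le> v"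
    and h: "L2_tendsto half_line (\<lambda>N. step_fun (xs N)) h"
    and X: "L2_tendsto M (\<lambda>N. step_integral B (xs N)) X"
    unfolding is_wiener_integral_def by blast
  have "(\<lambda>N. CLINT \<omega>|M. iexp (step_integral B (xs N) \<omega>))
    \<longlonglongrightarrow> of_real (exp (- (LINT s|half_line. (h s)\<^sup>2) / 2))"
    unfolding char_step_integral[OF xs]
    by (intro tendsto_intros L2_tendsto_square_integral h) auto
  with tendsto_char_L2[OF X] show ?thesis by (rule LIMSEQ_unique)
qed

section \<open>Linearity of the Wiener integral and joint characteristic functions\<close>

lemma is_wiener_integral_zero: "is_wiener_integral M B (\<lambda>_. 0) (\<lambda>_. 0)"
  unfolding is_wiener_integral_def
  by (intro exI[of _ "\<lambda>_. []"])
    (auto simp: L2_tendsto_def L2_fun_def step_fun_def[abs_def] step_integral_def[abs_def])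

text \<open>Since the intervals of a list may overlap, concatenating two lists adds both the step
  functions and their integrals.\<close>

lemma is_wiener_integral_add:
  assumes "is_wiener_integral M B h X" "is_wiener_integral M B g Y"
  shows "is_wiener_integral M B (\<lambda>s. h s + g s) (\<lambda>\<omega>. X \<omega> + Y \<omega>)"
proof -
  from assms obtain xs ys where xs: "\<And>N. \<forall>(c, u, v) \<in> set (xs N). 0 \<le> u \<and> u \<le> v"
    and h: "L2_tendsto half_line (\<lambda>N. step_fun (xs N)) h"
    and X: "L2_tendsto M (\<lambda>N. step_integral B (xs N)) X"
    and ys: "\<And>N. \<forall>(c, u, v) \<in> set (ys N). 0 \<le> u \<and> u \<le> v"
    and g: "L2_tendsto half_line (\<lambda>N. step_fun (ys N)) g"
    and Y: "L2_tendsto M (\<lambda>N. step_integral B (ys N)) Y"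
    unfolding is_wiener_integral_def by blast
  have "step_fun (xs N @ ys N) = (\<lambda>s. step_fun (xs N) s + step_fun (ys N) s)"
    "step_integral B (xs N @ ys N) = (\<lambda>\<omega>. step_integral B (xs N) \<omega> + step_integral B (ys N) \<omega>)" for N
    by (auto simp: step_fun_def[abs_def] step_integral_def[abs_def])
  moreover have "\<forall>(c, u, v) \<in> set (xs N @ ys N). 0 \<le> u \<and> u \<le> v" for N
    using xs[of N] ys[of N] by auto
  ultimately show ?thesis
    unfolding is_wiener_integral_def
    using L2_tendsto_add[OF h g] L2_tendsto_add[OF X Y]
    by (intro exI[of _ "\<lambda>N. xs N @ ys N"]) simp
qed

lemma is_wiener_integral_cmult:
  assumes "is_wiener_integral M B h X"
  shows "is_wiener_integral M B (\<lambda>s. a * h s) (\<lambda>\<omega>. a * X \<omega>)"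
proof -
  from assms obtain xs where xs: "\<And>N. \<forall>(c, u, v) \<in> set (xs N). 0 \<le> u \<and> u \<le> v"
    and h: "L2_tendsto half_line (\<lambda>N. step_fun (xs N)) h"
    and X: "L2_tendsto M (\<lambda>N. step_integral B (xs N)) X"
    unfolding is_wiener_integral_def by blast
  define sc where "sc = map (\<lambda>(c, u::real, v::real). (a * c, u, v))"
  have "step_fun (sc ys) s = a * step_fun ys s" for ys s
    by (induction ys) (auto simp: step_fun_def sc_def algebra_simps)
  then have 1: "step_fun (sc ys) = (\<lambda>s. a * step_fun ys s)" for ys by auto
  have "step_integral B (sc ys) s = a * step_integral B ys s" for ys s
    by (induction ys) (auto simp: step_integral_def sc_def algebra_simps)
  then have 2: "step_integral B (sc ys) = (\<lambda>s. a * step_integral B ys s)" for ys by auto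
  have "\<forall>(c, u, v) \<in> set (sc (xs N)). 0 \<le> u \<and> u \<le> v" for N
    using xs[of N] by (fastforce simp: sc_def)
  then show ?thesis
    unfolding is_wiener_integral_def
    using L2_tendsto_cmult[OF h] L2_tendsto_cmult[OF X]
    by (intro exI[of _ "\<lambda>N. sc (xs N)"]) (simp add: 1 2)
qed

lemma is_wiener_integral_sum:
  assumes "\<And>k. k \<in> K \<Longrightarrow> is_wiener_integral M B (h k) (W k)"
  shows "is_wiener_integral M B (\<lambda>s. \<Sum>k\<in>K. c k * h k s) (\<lambda>\<omega>. \<Sum>k\<in>K. c k * W k \<omega>)"
  using assms
  \<comment> \<open>For infinite \<open>K\<close> both sums are 0 by convention, which the zero
    integral covers.\<close>
  by (induction K rule: infinite_finite_induct)
    (auto intro!: is_wiener_integral_zero is_wiener_integral_add is_wiener_integral_cmult)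

lemma orthonormal_square_integral:
  assumes "L2_orthonormal_basis M h" "finite K"
  shows "(LINT x|M. (\<Sum>k\<in>K. c k * h k x)\<^sup>2) = (\<Sum>k\<in>K. (c k)\<^sup>2)"
proof -
  have h: "h k \<in> L2_fun M" "(LINT x|M. h j x * h k x) = (if j = k then 1 else 0)" for j k
    using assms by (auto simp: L2_orthonormal_basis_def)
  have "(LINT x|M. (\<Sum>k\<in>K. c k * h k x)\<^sup>2) = (LINT x|M. (\<Sum>j\<in>K. \<Sum>k\<in>K. c j * c k * (h j x * h k x)))"
    by (simp add: power2_eq_square sum_product mult_ac)
  also have "\<dots> = (\<Sum>j\<in>K. \<Sum>k\<in>K. c j * c k * (LINT x|M. h j x * h k x))"
    using L2_fun_integrable_mult[OF h(1) h(1)] by simp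
  also have "\<dots> = (\<Sum>k\<in>K. (c k)\<^sup>2)"
    using assms(2) by (simp add: h(2) power2_eq_square if_distrib[of "(*) _"] cong: if_cong)
  finally show ?thesis .
qed

text \<open>By linearity a combination of the integrals is itself a Wiener integral, so the
  one-dimensional formula already yields the joint characteristic function; orthonormality evaluates
  the norm.\<close>

lemma (in brownian_motion) joint_char_wiener_integrals:
  assumes "L2_orthonormal_basis half_line h" "\<And>k. is_wiener_integral M B (h k) (W k)" "finite K"
  shows "(CLINT \<omega>|M. iexp (\<Sum>k\<in>K. c k * W k \<omega>)) = of_real (exp (- (\<Sum>k\<in>K. (c k)\<^sup>2) / 2))"
proof -
  have "is_wiener_integral M B (\<lambda>s. \<Sum>k\<in>K. c k * h k s) (\<lambda>\<omega>. \<Sum>k\<in>K. c k * W k \<omega>)"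
    by (intro is_wiener_integral_sum assms(2))
  from char_wiener_integral[OF this] show ?thesis
    unfolding orthonormal_square_integral[OF assms(1,3)] .
qed

section \<open>Independence from characteristic functions\<close>

context prob_space
begin

lemma integrable_bounded:
  fixes f :: "'a \<Rightarrow> 'b::{banach, second_countable_topology}"
  assumes "f \<in> borel_measurable M" "\<And>\<omega>. norm (f \<omega>) \<le> c"
  shows "integrable M f"
  using assms by (intro integrable_const_bound[of _ c]) auto

text \<open>The distribution of \<open>W\<close> under \<open>Y dP\<close>, normalised, has the characteristic function of \<open>W\<close>.\<close>

lemma indicator_factorizes_of_char_factorizes:
  fixes Y W :: "'a \<Rightarrow> real"
  assumes [measurable]: "Y \<in> borel_measurable M" "W \<in> borel_measurable M" "A \<in> sets borel"
    and bound: "\<And>\<omega>. 0 \<le> Y \<omega>" "\<And>\<omega>. Y \<omega> \<le> c"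
    and fact: "\<And>t. (CLINT \<omega>|M. of_real (Y \<omega>) * iexp (t * W \<omega>))
      = of_real (LINT \<omega>|M. Y \<omega>) * (CLINT \<omega>|M. iexp (t * W \<omega>))"
  shows "(LINT \<omega>|M. Y \<omega> * indicator A (W \<omega>)) = (LINT \<omega>|M. Y \<omega>) * prob (W -` A \<inter> space M)"
proof -
  define e where "e = (LINT \<omega>|M. Y \<omega>)"
  have intY: "integrable M Y"
    using bound by (intro integrable_bounded[of _ c]) auto
  have "e \<ge> 0" unfolding e_def using bound by simp
  show ?thesis
  proof (cases "e = 0")
    \<comment> \<open>Normalisation by \<open>e\<close> is impossible here, but a nonnegative
      function with integral 0 vanishes almost everywhere, so both sides are 0.\<close>
    case True
    then have "AE \<omega> in M. Y \<omega> = 0"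
      using integral_nonneg_eq_0_iff_AE[OF intY] bound by (simp add: e_def)
    then have "(LINT \<omega>|M. Y \<omega> * indicator A (W \<omega>)) = (LINT \<omega>|M. 0)"
      by (intro integral_cong_AE) auto
    with True show ?thesis by (simp add: e_def)
  next
    case False
    with \<open>e \<ge> 0\<close> have e: "e > 0" by simp
    define N where "N = density M (\<lambda>\<omega>. ennreal (Y \<omega> / e))"
    have [measurable]: "W \<in> borel_measurable N" and sN: "space N = space M"
      by (auto simp: N_def)
    interpret N: prob_space N
    proof
      have "emeasure N (space N) = (\<integral>\<^sup>+\<omega>. ennreal (Y \<omega> / e) \<partial>M)"
        by (simp add: N_def emeasure_density cong: nn_integral_cong)
      also have "\<dots> = ennreal (LINT \<omega>|M. Y \<omega> / e)"
        using intY bound e by (intro nn_integral_eq_integral) auto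
      also have "\<dots> = 1" using e by (simp add: e_def)
      finally show "emeasure N (space N) = 1" .
    qed
    interpret D: real_distribution "distr M borel W" by (intro real_distribution_distr) auto
    interpret E: real_distribution "distr N borel W" by (intro N.real_distribution_distr) auto
    have "char (distr N borel W) = char (distr M borel W)"
    proof
      fix t
      have "char (distr N borel W) t = (CLINT \<omega>|N. iexp (t * W \<omega>))"
        unfolding char_def by (subst integral_distr) auto
      also have "\<dots> = (CLINT \<omega>|M. (Y \<omega> / e) *\<^sub>R iexp (t * W \<omega>))"
        unfolding N_def using bound e by (intro integral_density) auto
      also have "\<dots> = (CLINT \<omega>|M. of_real (1 / e) * (of_real (Y \<omega>) * iexp (t * W \<omega>)))"
        by (intro Bochner_Integration.integral_cong) (auto simp: scaleR_conv_of_real)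
      also have "\<dots> = of_real (1 / e) * (CLINT \<omega>|M. of_real (Y \<omega>) * iexp (t * W \<omega>))"
        by (rule integral_mult_right_zero)
      also have "\<dots> = (CLINT \<omega>|M. iexp (t * W \<omega>))"
        unfolding fact using e by (simp add: e_def[symmetric])
      also have "\<dots> = char (distr M borel W) t"
        unfolding char_def by (subst integral_distr) auto
      finally show "char (distr N borel W) t = char (distr M borel W) t" .
    qed
    then have eq: "distr N borel W = distr M borel W"
      by (intro Levy_uniqueness E.real_distribution_axioms D.real_distribution_axioms)
    have "(LINT x|distr N borel W. indicator A x :: real) = (LINT x|distr M borel W. indicator A x)"
      by (simp only: eq)
    then have "(LINT \<omega>|N. indicator A (W \<omega>)) = (LINT \<omega>|M. indicator A (W \<omega>) :: real)"
      by (simp only: integral_distr[of W N borel] integral_distr[of W M borel] \<open>W \<in> borel_measurable N\<close>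
          assms(2) borel_measurable_indicator[OF assms(3)])
    also have "(LINT \<omega>|N. indicator A (W \<omega>) :: real) = (LINT \<omega>|M. (Y \<omega> / e) *\<^sub>R indicator A (W \<omega>))"
      unfolding N_def using bound e by (intro integral_density) auto
    also have "\<dots> = (LINT \<omega>|M. Y \<omega> * indicator A (W \<omega>)) / e"
      by simp
    also have "(LINT \<omega>|M. indicator A (W \<omega>) :: real) = prob (W -` A \<inter> space M)"
    proof -
      have "(LINT \<omega>|M. indicator A (W \<omega>) :: real) = (LINT \<omega>|M. indicator (W -` A \<inter> space M) \<omega>)"
        by (intro Bochner_Integration.integral_cong) (auto simp: indicator_def)
      then show ?thesis by simp
    qed
    finally show ?thesis using e by (simp add: e_def field_simps)
  qed
qed

text \<open>The hypothesis passes to \<open>cnj Z\<close>, hence to the nonnegative density \<open>1 + Re Z\<close>.\<close>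

lemma indicator_Re_factorizes_of_char_factorizes:
  fixes Z :: "'a \<Rightarrow> complex" and W :: "'a \<Rightarrow> real"
  assumes [measurable]: "Z \<in> borel_measurable M" "W \<in> borel_measurable M" "A \<in> sets borel"
    and bound: "\<And>\<omega>. cmod (Z \<omega>) \<le> 1"
    and fact: "\<And>t. (CLINT \<omega>|M. Z \<omega> * iexp (t * W \<omega>)) = (CLINT \<omega>|M. Z \<omega>) * (CLINT \<omega>|M. iexp (t * W \<omega>))"
  shows "(LINT \<omega>|M. Re (Z \<omega>) * indicator A (W \<omega>)) = (LINT \<omega>|M. Re (Z \<omega>)) * prob (W -` A \<inter> space M)"
proof -
  have Re: "\<bar>Re (Z \<omega>)\<bar> \<le> 1" for \<omega>
    using abs_Re_le_cmod[of "Z \<omega>"] bound[of \<omega>] by linarith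
  have [measurable]: "(\<lambda>\<omega>. cnj (Z \<omega>)) \<in> borel_measurable M"
    by (rule borel_measurable_continuous_on[OF _ assms(1)]) (intro continuous_intros)
  have int: "integrable M Z" "integrable M (\<lambda>\<omega>. cnj (Z \<omega>))" "integrable M (\<lambda>\<omega>. Re (Z \<omega>))"
    "integrable M (\<lambda>\<omega>. Z \<omega> * iexp (t * W \<omega>))" "integrable M (\<lambda>\<omega>. cnj (Z \<omega>) * iexp (t * W \<omega>))"
    "integrable M (\<lambda>\<omega>. iexp (t * W \<omega>))" "integrable M (\<lambda>\<omega>. indicator A (W \<omega>) :: real)"
    "integrable M (\<lambda>\<omega>. Re (Z \<omega>) * indicator A (W \<omega>))" for t
    using bound Re by (auto intro!: integrable_bounded[of _ 1] simp: norm_mult indicator_def simp del: of_real_mult)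
  have conj: "(CLINT \<omega>|M. cnj (Z \<omega>) * iexp (t * W \<omega>))
      = cnj (CLINT \<omega>|M. Z \<omega>) * (CLINT \<omega>|M. iexp (t * W \<omega>))" for t
  proof -
    \<comment> \<open>Conjugation reverses the frequency, so the hypothesis at \<open>- t\<close>
      gives the one for \<open>cnj Z\<close> at \<open>t\<close>.\<close>
    have e: "iexp (t * W \<omega>) = cnj (iexp (- t * W \<omega>))" for \<omega>
      by (simp add: exp_cnj)
    have "(CLINT \<omega>|M. cnj (Z \<omega>) * iexp (t * W \<omega>)) = cnj (CLINT \<omega>|M. Z \<omega> * iexp (- t * W \<omega>))"
      unfolding e complex_cnj_mult[symmetric] Bochner_Integration.integral_cnj ..
    moreover have "(CLINT \<omega>|M. iexp (t * W \<omega>)) = cnj (CLINT \<omega>|M. iexp (- t * W \<omega>))"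
      unfolding e Bochner_Integration.integral_cnj ..
    ultimately show ?thesis unfolding fact[of "- t"] by simp
  qed
  have "(LINT \<omega>|M. (1 + Re (Z \<omega>)) * indicator A (W \<omega>))
      = (LINT \<omega>|M. 1 + Re (Z \<omega>)) * prob (W -` A \<inter> space M)"
  \<comment> \<open>Since the modulus of \<open>Z\<close> is at most 1, the density
    \<open>1 + Re Z\<close> takes values between 0 and 2.\<close>
  proof (rule indicator_factorizes_of_char_factorizes[where c = 2])
    fix t
    have Reint: "of_real (LINT \<omega>|M. 1 + Re (Z \<omega>)) = 1 + ((CLINT \<omega>|M. Z \<omega>) + cnj (CLINT \<omega>|M. Z \<omega>)) / 2"
      using int(1) int(3) by (simp add: prob_space complex_add_cnj)
    have "(CLINT \<omega>|M. of_real (1 + Re (Z \<omega>)) * iexp (t * W \<omega>))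
        = (CLINT \<omega>|M. iexp (t * W \<omega>) + (Z \<omega> * iexp (t * W \<omega>) + cnj (Z \<omega>) * iexp (t * W \<omega>)) / 2)"
    proof (intro Bochner_Integration.integral_cong refl)
      fix \<omega>
      have "of_real (1 + Re (Z \<omega>)) = 1 + (Z \<omega> + cnj (Z \<omega>)) / 2" by (simp add: complex_add_cnj)
      then show "of_real (1 + Re (Z \<omega>)) * iexp (t * W \<omega>)
          = iexp (t * W \<omega>) + (Z \<omega> * iexp (t * W \<omega>) + cnj (Z \<omega>) * iexp (t * W \<omega>)) / 2"
        by (simp only: distrib_left distrib_right add_divide_distrib) simp
    qed
    also have "\<dots> = (CLINT \<omega>|M. iexp (t * W \<omega>)) +
        ((CLINT \<omega>|M. Z \<omega> * iexp (t * W \<omega>)) + (CLINT \<omega>|M. cnj (Z \<omega>) * iexp (t * W \<omega>))) / 2"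
      using int(4-6) by simp
    also have "\<dots> = of_real (LINT \<omega>|M. 1 + Re (Z \<omega>)) * (CLINT \<omega>|M. iexp (t * W \<omega>))"
      unfolding fact conj Reint by (simp add: algebra_simps add_divide_distrib)
    finally show "(CLINT \<omega>|M. of_real (1 + Re (Z \<omega>)) * iexp (t * W \<omega>))
      = of_real (LINT \<omega>|M. 1 + Re (Z \<omega>)) * (CLINT \<omega>|M. iexp (t * W \<omega>))" .
  qed (use Re in \<open>auto simp: abs_le_iff\<close>, (smt (verit) Re)+)
  moreover have "(LINT \<omega>|M. indicator A (W \<omega>) :: real) = prob (W -` A \<inter> space M)"
  proof -
    have "(LINT \<omega>|M. indicator A (W \<omega>) :: real) = (LINT \<omega>|M. indicator (W -` A \<inter> space M) \<omega>)"
      by (intro Bochner_Integration.integral_cong) (auto simp: indicator_def)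
    then show ?thesis by simp
  qed
  ultimately show ?thesis
    using int by (simp add: distrib_right prob_space)
qed

text \<open>The imaginary part of \<open>Z\<close> is the real part of \<open>- \<i> * Z\<close>,
  which satisfies the same hypotheses; the real and imaginary parts are then recombined.\<close>

lemma complex_indicator_factorizes_of_char_factorizes:
  fixes Z :: "'a \<Rightarrow> complex" and W :: "'a \<Rightarrow> real"
  assumes [measurable]: "Z \<in> borel_measurable M" "W \<in> borel_measurable M" "A \<in> sets borel"
    and bound: "\<And>\<omega>. cmod (Z \<omega>) \<le> 1"
    and fact: "\<And>t. (CLINT \<omega>|M. Z \<omega> * iexp (t * W \<omega>)) = (CLINT \<omega>|M. Z \<omega>) * (CLINT \<omega>|M. iexp (t * W \<omega>))"
  shows "(CLINT \<omega>|M. Z \<omega> * indicator A (W \<omega>)) = (CLINT \<omega>|M. Z \<omega>) * of_real (prob (W -` A \<inter> space M))"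
proof -
  have int: "integrable M Z" "integrable M (\<lambda>\<omega>. Z \<omega> * indicator A (W \<omega>))"
    using bound by (auto intro!: integrable_bounded[of _ 1] simp: norm_mult indicator_def)
  have "(LINT \<omega>|M. Re (- \<i> * Z \<omega>) * indicator A (W \<omega>))
      = (LINT \<omega>|M. Re (- \<i> * Z \<omega>)) * prob (W -` A \<inter> space M)"
  proof (rule indicator_Re_factorizes_of_char_factorizes)
    fix t
    show "(CLINT \<omega>|M. - \<i> * Z \<omega> * iexp (t * W \<omega>))
        = (CLINT \<omega>|M. - \<i> * Z \<omega>) * (CLINT \<omega>|M. iexp (t * W \<omega>))"
      unfolding mult.assoc integral_mult_right_zero fact ..
  qed (use bound in \<open>auto simp: norm_mult\<close>)
  then have "(LINT \<omega>|M. Im (Z \<omega>) * indicator A (W \<omega>)) = (LINT \<omega>|M. Im (Z \<omega>)) * prob (W -` A \<inter> space M)"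
    by simp
  moreover have "Re (Z \<omega> * indicator A (W \<omega>)) = Re (Z \<omega>) * indicator A (W \<omega>)"
    "Im (Z \<omega> * indicator A (W \<omega>)) = Im (Z \<omega>) * indicator A (W \<omega>)" for \<omega>
    by (auto simp: indicator_def)
  ultimately show ?thesis
    using indicator_Re_factorizes_of_char_factorizes[OF assms] int
    by (simp add: complex_eq_iff flip: integral_Re integral_Im)
qed

text \<open>Uniqueness of characteristic functions is applied on the real line only, to one
  coordinate at a time; the other coordinates are absorbed into a bounded complex weight.\<close>

lemma indep_vars_of_char_factorizes:
  fixes W :: "'i \<Rightarrow> 'a \<Rightarrow> real"
  assumes "finite I" and rv: "\<And>k. k \<in> I \<Longrightarrow> W k \<in> borel_measurable M"
    and fact: "\<And>c. (CLINT \<omega>|M. iexp (\<Sum>k\<in>I. c k * W k \<omega>)) = (\<Prod>k\<in>I. CLINT \<omega>|M. iexp (c k * W k \<omega>))"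
  shows "indep_vars (\<lambda>_. borel) W I"
proof (cases "I = {}")
  \<comment> \<open>Treated apart, because an intersection over no indices would be the whole type
    instead of \<open>space M\<close>.\<close>
  case True
  then show ?thesis by (simp add: indep_vars_def indep_sets_def)
next
  case False
  txt \<open>The exponentials are exchanged for indicators one index at a time.\<close>
  have key: "J \<subseteq> I \<longrightarrow> (\<forall>A c. (\<forall>k. A k \<in> sets borel) \<longrightarrow>
      (CLINT \<omega>|M. (\<Prod>k\<in>J. indicator (A k) (W k \<omega>)) * iexp (\<Sum>k\<in>I - J. c k * W k \<omega>))
    = (\<Prod>k\<in>J. of_real (prob (W k -` A k \<inter> space M))) * (\<Prod>k\<in>I - J. CLINT \<omega>|M. iexp (c k * W k \<omega>)))"
    if "finite J" for J
    using that
  proof (induction J)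
    case empty
    then show ?case using fact by simp
  next
    case (insert j J)
    show ?case
    proof (intro impI allI)
      fix A :: "'i \<Rightarrow> real set" and c :: "'i \<Rightarrow> real"
      assume sub: "insert j J \<subseteq> I" and A: "\<forall>k. A k \<in> sets borel"
      define K where "K = I - insert j J"
      have K: "finite K" "j \<notin> K" "I - J = insert j K" "K \<subseteq> I" "J \<subseteq> I" "j \<in> I"
        using sub insert.hyps assms(1) by (auto simp: K_def)
      \<comment> \<open>The weight collects the indicators already introduced and the exponentials
        still to be exchanged, leaving out the coordinate \<open>j\<close>.\<close>
      define Z where "Z \<omega> = (\<Prod>k\<in>J. indicator (A k) (W k \<omega>)) * iexp (\<Sum>k\<in>K. c k * W k \<omega>)" for \<omega>
      define z where "z = (\<Prod>k\<in>J. of_real (prob (W k -` A k \<inter> space M))) * (\<Prod>k\<in>K. CLINT \<omega>|M. iexp (c k * W k \<omega>))"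
      have Z: "(CLINT \<omega>|M. Z \<omega> * iexp (t * W j \<omega>)) = z * (CLINT \<omega>|M. iexp (t * W j \<omega>))" for t
      proof -
        \<comment> \<open>The induction hypothesis holds for all frequencies, so the one at
          \<open>j\<close> can be set to an arbitrary \<open>t\<close> while the others stay
          fixed.\<close>
        have "(CLINT \<omega>|M. (\<Prod>k\<in>J. indicator (A k) (W k \<omega>)) * iexp (\<Sum>k\<in>I - J. (c(j := t)) k * W k \<omega>))
            = (\<Prod>k\<in>J. of_real (prob (W k -` A k \<inter> space M))) * (\<Prod>k\<in>I - J. CLINT \<omega>|M. iexp ((c(j := t)) k * W k \<omega>))"
          using insert.IH K(5) A by blast
        moreover have "(\<Sum>k\<in>I - J. (c(j := t)) k * W k \<omega>) = t * W j \<omega> + (\<Sum>k\<in>K. c k * W k \<omega>)" for \<omega>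
          unfolding K(3) using K(1,2) by (auto intro!: sum.cong)
        moreover have "(\<Prod>k\<in>I - J. CLINT \<omega>|M. iexp ((c(j := t)) k * W k \<omega>))
            = (CLINT \<omega>|M. iexp (t * W j \<omega>)) * (\<Prod>k\<in>K. CLINT \<omega>|M. iexp (c k * W k \<omega>))"
          unfolding K(3) using K(1,2) by (auto intro!: prod.cong)
        ultimately show ?thesis
          by (simp add: Z_def z_def distrib_left exp_add mult_ac del: of_real_sum of_real_mult)
      qed
      \<comment> \<open>Frequency 0 identifies the constant \<open>z\<close> as the expectation of
        the weight.\<close>
      from Z[of 0] have z: "(CLINT \<omega>|M. Z \<omega>) = z" by (simp add: prob_space)
      have [measurable]: "Z \<in> borel_measurable M"
        unfolding Z_def using rv K(4,5) A
        by (intro borel_measurable_times borel_measurable_prod borel_measurable_continuous_on[OF _ borel_measurable_sum]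
            measurable_compose[OF _ borel_measurable_indicator] continuous_intros borel_measurable_const) auto
      have "(CLINT \<omega>|M. Z \<omega> * indicator (A j) (W j \<omega>)) = (CLINT \<omega>|M. Z \<omega>) * of_real (prob (W j -` A j \<inter> space M))"
      proof (rule complex_indicator_factorizes_of_char_factorizes)
        show "cmod (Z \<omega>) \<le> 1" for \<omega>
          unfolding Z_def norm_mult norm_exp_i_times
          by (auto simp: prod_norm[symmetric] indicator_def intro!: prod_le_1)
      qed (use rv K(6) A Z z in auto)
      then show "(CLINT \<omega>|M. (\<Prod>k\<in>insert j J. indicator (A k) (W k \<omega>)) * iexp (\<Sum>k\<in>I - insert j J. c k * W k \<omega>))
        = (\<Prod>k\<in>insert j J. of_real (prob (W k -` A k \<inter> space M)))
          * (\<Prod>k\<in>I - insert j J. CLINT \<omega>|M. iexp (c k * W k \<omega>))"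
        using insert.hyps unfolding K_def[symmetric] z
        by (simp add: Z_def z_def mult_ac)
    qed
  qed
  show ?thesis
  proof (subst indep_vars_finite[where E = "\<lambda>_. sets borel"])
    show "\<forall>A\<in>I \<rightarrow> sets borel. prob (\<Inter>j\<in>I. W j -` A j \<inter> space M) = (\<Prod>j\<in>I. prob (W j -` A j \<inter> space M))"
    proof
      fix A :: "'i \<Rightarrow> real set" assume A: "A \<in> I \<rightarrow> sets borel"
      \<comment> \<open>\<open>key\<close> asks for a Borel set at every index, also outside
        \<open>I\<close>, where the empty set is inserted.\<close>
      define A' where "A' k = (if k \<in> I then A k else {})" for k
      have "\<forall>k. A' k \<in> sets borel" using A by (auto simp: A'_def)
      then have "(CLINT \<omega>|M. (\<Prod>k\<in>I. indicator (A' k) (W k \<omega>)))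
          = (\<Prod>k\<in>I. of_real (prob (W k -` A' k \<inter> space M)))"
        using key[OF assms(1)] by simp
      moreover have "(CLINT \<omega>|M. (\<Prod>k\<in>I. indicator (A' k) (W k \<omega>)))
          = (CLINT \<omega>|M. of_real (indicator (\<Inter>j\<in>I. W j -` A j \<inter> space M) \<omega>))"
      proof (intro Bochner_Integration.integral_cong refl)
        fix \<omega> assume "\<omega> \<in> space M"
        then show "(\<Prod>k\<in>I. indicator (A' k) (W k \<omega>)) = (of_real (indicator (\<Inter>j\<in>I. W j -` A j \<inter> space M) \<omega>) :: complex)"
          using assms(1) False by (auto simp: indicator_def A'_def)
      qed
      moreover have "(\<Inter>j\<in>I. W j -` A j \<inter> space M) \<in> events"
        using A rv by (intro sets.finite_INT assms(1) False measurable_sets) auto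
      ultimately have "of_real (prob (\<Inter>j\<in>I. W j -` A j \<inter> space M))
          = (of_real (\<Prod>k\<in>I. prob (W k -` A' k \<inter> space M)) :: complex)"
        by simp
      then have "prob (\<Inter>j\<in>I. W j -` A j \<inter> space M) = (\<Prod>k\<in>I. prob (W k -` A' k \<inter> space M))"
        using of_real_eq_iff by blast
      then show "prob (\<Inter>j\<in>I. W j -` A j \<inter> space M) = (\<Prod>j\<in>I. prob (W j -` A j \<inter> space M))"
        by (simp add: A'_def cong: prod.cong)
    qed
  qed (use assms False sets.sigma_sets_eq[of "borel :: real measure"] in \<open>auto simp: Int_stable_def\<close>)
qed

end

section \<open>Independence and law of the integrals of an orthonormal basis\<close>

context brownian_motion
begin

text \<open>The joint exponent is a sum of squares without mixed terms, so the characteristic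
  function factorises; a single index gives that of the standard normal law.\<close>

lemma
  assumes "L2_orthonormal_basis half_line h" "\<And>k. is_wiener_integral M B (h k) (W k)"
  shows indep_vars_wiener_integrals: "finite K \<Longrightarrow> indep_vars (\<lambda>_. borel) W K"
    and distr_wiener_integral: "distr M borel (W k) = std_normal_distribution"
proof -
  note joint = joint_char_wiener_integrals[OF assms]
  have single: "(CLINT \<omega>|M. iexp (t * W k \<omega>)) = of_real (exp (- t\<^sup>2 / 2))" for t k
    using joint[of "{k}" "\<lambda>_. t"] by simp
  have rv [measurable]: "W k \<in> borel_measurable M" for k
    using assms(2)[of k] by (auto simp: is_wiener_integral_def L2_tendsto_def L2_fun_def)
  show "indep_vars (\<lambda>_. borel) W K" if "finite K" for K
  proof (rule indep_vars_of_char_factorizes[OF that])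
    fix c
    show "(CLINT \<omega>|M. iexp (\<Sum>k\<in>K. c k * W k \<omega>)) = (\<Prod>k\<in>K. CLINT \<omega>|M. iexp (c k * W k \<omega>))"
      unfolding joint[OF that] single of_real_prod[symmetric] exp_sum[OF that, symmetric]
      by (simp add: sum_negf sum_divide_distrib)
  qed (rule rv)
  interpret D: real_distribution "distr M borel (W k)" by (intro real_distribution_distr) auto
  show "distr M borel (W k) = std_normal_distribution"
  proof (rule Levy_uniqueness)
    show "real_distribution (distr M borel (W k))" by unfold_locales
    show "char (distr M borel (W k)) = char std_normal_distribution"
      unfolding char_std_normal_distribution char_def
      by (subst integral_distr) (auto simp: single simp del: of_real_mult)
  qed (rule real_dist_normal_dist)
qed

end

section \<open>Exponential moments and tails of quadratic Gaussian series\<close>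

text \<open>Completing the square: the weight changes the variance from 1 to
  \<open>1 / (1 - s)\<close>, and the value is the ratio of the normalising constants. The condition
  \<open>s < 1\<close> is the source of the critical exponent.\<close>

lemma nn_integral_std_normal_exp_square:
  assumes "s < 1"
  shows "(\<integral>\<^sup>+x. ennreal (exp (s * x\<^sup>2 / 2)) \<partial>std_normal_distribution) = ennreal (1 / sqrt (1 - s))"
proof -
  define \<sigma> where "\<sigma> = 1 / sqrt (1 - s)"
  have \<sigma>: "\<sigma> > 0" "\<sigma>\<^sup>2 = 1 / (1 - s)" using assms by (auto simp: \<sigma>_def power_divide)
  have eq: "std_normal_density x * exp (s * x\<^sup>2 / 2) = \<sigma> * normal_density 0 \<sigma> x" for x
  proof -
    have "sqrt (2 * pi * \<sigma>\<^sup>2) = sqrt (2 * pi) * \<sigma>"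
      using \<sigma>(1) by (simp add: real_sqrt_mult)
    moreover have "- x\<^sup>2 / 2 + s * x\<^sup>2 / 2 = - (x - 0)\<^sup>2 / (2 * \<sigma>\<^sup>2)"
      unfolding \<sigma>(2) by (simp add: algebra_simps diff_divide_distrib)
    ultimately show ?thesis
      using \<sigma>(1) unfolding normal_density_def by (simp add: mult_exp_exp)
  qed
  have "(\<integral>\<^sup>+x. ennreal (exp (s * x\<^sup>2 / 2)) \<partial>std_normal_distribution)
      = (\<integral>\<^sup>+x. ennreal (\<sigma>) * ennreal (normal_density 0 \<sigma> x) \<partial>lborel)"
    using \<sigma> by (subst nn_integral_density) (auto simp: eq simp flip: ennreal_mult')
  also have "\<dots> = ennreal \<sigma> * (\<integral>\<^sup>+x. ennreal (normal_density 0 \<sigma> x) \<partial>lborel)"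
    by (rule nn_integral_cmult) auto
  also have "(\<integral>\<^sup>+x. ennreal (normal_density 0 \<sigma> x) \<partial>lborel) = 1"
    using \<sigma> by (subst nn_integral_eq_integral) auto
  finally show ?thesis by (simp add: \<sigma>_def)
qed

text \<open>Centring cancels the linear term of the logarithm, and \<open>ln z \<le> z - 1\<close>
  bounds what is left by a multiple of \<open>y\<^sup>2\<close>. The constant depends only on
  \<open>r\<close>, so the bound is uniform over all eigenvalues.\<close>

lemma exp_over_sqrt_bound:
  fixes y r :: real
  assumes "y \<le> r" "r < 1"
  shows "exp (- y / 2) / sqrt (1 - y) \<le> exp (y\<^sup>2 / (2 * (1 - r)))"
proof -
  have y: "1 - y > 0" using assms by simp
  have "ln (1 / (1 - y)) \<le> 1 / (1 - y) - 1"
    using y by (intro ln_le_minus_one) simp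
  also have "\<dots> = y + y\<^sup>2 / (1 - y)"
    using y by (simp add: field_simps power2_eq_square)
  also have "\<dots> \<le> y + y\<^sup>2 / (1 - r)"
    using assms by (intro add_left_mono divide_left_mono mult_pos_pos) auto
  finally have "- ln (1 - y) \<le> y + y\<^sup>2 / (1 - r)"
    using y by (simp add: ln_div)
  then have *: "- y / 2 - ln (1 - y) / 2 \<le> u / 2" if "u = y\<^sup>2 / (1 - r)" for u
    unfolding that[symmetric] by linarith
  have "- y / 2 - ln (1 - y) / 2 \<le> y\<^sup>2 / (2 * (1 - r))"
    using *[OF refl] unfolding divide_divide_eq_left by (simp only: mult.commute)
  then have "exp (- y / 2 - ln (1 - y) / 2) \<le> exp (y\<^sup>2 / (2 * (1 - r)))"
    by simp
  moreover have "exp (ln (1 - y) / 2) = sqrt (1 - y)"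
    using y by (simp flip: ln_sqrt)
  ultimately show ?thesis by (simp add: exp_diff)
qed

text \<open>The density decreases on the nonnegative axis, so over the unit interval from
  \<open>t\<close> to \<open>t + 1\<close> it is at least its value at the right end. The shift by 1
  does not affect the exponential rate.\<close>

lemma std_normal_tail_lower:
  assumes "0 \<le> t"
  shows "std_normal_density (t + 1) \<le> measure std_normal_distribution {t..}"
proof -
  interpret real_distribution std_normal_distribution by (rule real_dist_normal_dist)
  have "ennreal (std_normal_density (t + 1)) = (\<integral>\<^sup>+x. ennreal (std_normal_density (t + 1)) * indicator {t..t + 1} x \<partial>lborel)"
    by (subst nn_integral_cmult_indicator) auto
  also have "\<dots> \<le> (\<integral>\<^sup>+x. ennreal (std_normal_density x) * indicator {t..} x \<partial>lborel)"
  proof (rule nn_integral_mono)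
    fix x :: real
    have "std_normal_density (t + 1) \<le> std_normal_density x" if "t \<le> x" "x \<le> t + 1"
      using that assms unfolding std_normal_density_def
      by (intro mult_left_mono) (auto intro!: power_mono)
    then show "ennreal (std_normal_density (t + 1)) * indicator {t..t + 1} x
        \<le> ennreal (std_normal_density x) * indicator {t..} x"
      by (auto simp: indicator_def intro: ennreal_leI)
  qed
  also have "\<dots> = emeasure std_normal_distribution {t..}"
    by (subst emeasure_density) auto
  also have "\<dots> = ennreal (measure std_normal_distribution {t..})"
    by (rule emeasure_eq_measure)
  finally show ?thesis by (simp add: ennreal_le_iff)
qed

section \<open>Quadratic series in independent standard normal variables\<close>

context prob_space
begin

text \<open>The condition on \<open>\<theta> * a k\<close> is one-sided and \<open>\<theta>\<close>
  may be negative, so that the bound can be applied to both tails.\<close>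

lemma gaussian_chaos_mgf_bound:
  fixes W :: "nat \<Rightarrow> 'a \<Rightarrow> real"
  assumes indep: "\<And>N. indep_vars (\<lambda>_. borel) W {..<N}"
    and distr: "\<And>k. distr M borel (W k) = std_normal_distribution"
    and sq: "summable (\<lambda>k. (a k)\<^sup>2)"
    and lim: "L2_tendsto M (\<lambda>N \<omega>. 1 / 2 * (\<Sum>k<N. a k * ((W k \<omega>)\<^sup>2 - 1))) J"
    and r: "\<And>k. \<theta> * a k \<le> r" "r < 1"
  shows "(\<integral>\<^sup>+\<omega>. ennreal (exp (\<theta> * J \<omega>)) \<partial>M) \<le> ennreal (exp (\<theta>\<^sup>2 * (\<Sum>k. (a k)\<^sup>2) / (2 * (1 - r))))"
proof -
  define F where "F N \<omega> = 1 / 2 * (\<Sum>k<N. a k * ((W k \<omega>)\<^sup>2 - 1))" for N \<omega>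
  have L2: "F N \<in> L2_fun M" "J \<in> L2_fun M"
    and to0: "(\<lambda>N. LINT \<omega>|M. (F N \<omega> - J \<omega>)\<^sup>2) \<longlonglongrightarrow> 0" for N
    using lim unfolding L2_tendsto_def F_def by auto
  have F [measurable]: "F N \<in> borel_measurable M" and [measurable]: "J \<in> borel_measurable M" for N
    using L2 by (auto simp: L2_fun_def)
  have [measurable]: "W k \<in> borel_measurable M" for k
    using indep[of "Suc k"] by (auto simp: indep_vars_def2)
  define g where "g k x = ennreal (exp (\<theta> * a k * (x\<^sup>2 - 1) / 2))" for k and x :: real
  have [measurable]: "g k \<in> borel_measurable borel" for k unfolding g_def[abs_def] by measurable
  have factor: "(\<integral>\<^sup>+\<omega>. g k (W k \<omega>) \<partial>M) \<le> ennreal (exp ((\<theta> * a k)\<^sup>2 / (2 * (1 - r))))" for k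
  proof -
    define y where "y = \<theta> * a k"
    have y: "y \<le> r" "y < 1" using r(1)[of k] r(2) by (auto simp: y_def)
    have "(\<integral>\<^sup>+\<omega>. g k (W k \<omega>) \<partial>M) = (\<integral>\<^sup>+x. g k x \<partial>distr M borel (W k))"
      by (subst nn_integral_distr) auto
    also have "\<dots> = (\<integral>\<^sup>+x. ennreal (exp (- y / 2)) * ennreal (exp (y * x\<^sup>2 / 2)) \<partial>std_normal_distribution)"
      unfolding distr g_def
      by (intro nn_integral_cong)
        (simp add: y_def algebra_simps diff_divide_distrib mult_exp_exp flip: ennreal_mult')
    also have "\<dots> = ennreal (exp (- y / 2)) * ennreal (1 / sqrt (1 - y))"
      by (subst nn_integral_cmult) (auto simp: nn_integral_std_normal_exp_square[OF y(2)])
    also have "\<dots> = ennreal (exp (- y / 2) / sqrt (1 - y))"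
      using y by (simp flip: ennreal_mult')
    also have "\<dots> \<le> ennreal (exp (y\<^sup>2 / (2 * (1 - r))))"
      using exp_over_sqrt_bound[OF y(1) r(2)] by (rule ennreal_leI)
    finally show ?thesis by (simp add: y_def)
  qed
  have partial: "(\<integral>\<^sup>+\<omega>. ennreal (exp (\<theta> * F N \<omega>)) \<partial>M) \<le> ennreal (exp (\<theta>\<^sup>2 * (\<Sum>k. (a k)\<^sup>2) / (2 * (1 - r))))" for N
  proof -
    have "\<theta> * F N \<omega> = (\<Sum>k<N. \<theta> * a k * ((W k \<omega>)\<^sup>2 - 1) / 2)" for \<omega>
      unfolding F_def by (simp add: sum_distrib_left sum_divide_distrib mult.assoc)
    then have "(\<integral>\<^sup>+\<omega>. ennreal (exp (\<theta> * F N \<omega>)) \<partial>M) = (\<integral>\<^sup>+\<omega>. (\<Prod>k<N. g k (W k \<omega>)) \<partial>M)"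
      by (simp add: exp_sum g_def prod_ennreal)
    also have "\<dots> = (\<Prod>k<N. \<integral>\<^sup>+\<omega>. g k (W k \<omega>) \<partial>M)"
      by (intro indep_vars_nn_integral indep_vars_compose2[OF indep]) auto
    also have "\<dots> \<le> (\<Prod>k<N. ennreal (exp ((\<theta> * a k)\<^sup>2 / (2 * (1 - r)))))"
      by (intro prod_mono_ennreal factor)
    also have "\<dots> = ennreal (exp (\<Sum>k<N. (\<theta> * a k)\<^sup>2 / (2 * (1 - r))))"
      by (simp add: prod_ennreal exp_sum)
    also have "\<dots> \<le> ennreal (exp (\<theta>\<^sup>2 * (\<Sum>k. (a k)\<^sup>2) / (2 * (1 - r))))"
    proof -
      have "(\<Sum>k<N. (\<theta> * a k)\<^sup>2 / (2 * (1 - r))) = \<theta>\<^sup>2 * (\<Sum>k<N. (a k)\<^sup>2) / (2 * (1 - r))"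
        by (simp add: power_mult_distrib sum_distrib_left sum_divide_distrib)
      also have "\<dots> \<le> \<theta>\<^sup>2 * (\<Sum>k. (a k)\<^sup>2) / (2 * (1 - r))"
        using r(2) by (intro divide_right_mono mult_left_mono sum_le_suminf sq) auto
      finally show ?thesis by (intro ennreal_leI) simp
    qed
    finally show ?thesis .
  qed
  \<comment> \<open>Convergence in L^2 gives almost sure convergence along a subsequence, which is
    enough for Fatou because the bound on the partial sums is uniform.\<close>
  have "\<exists>s::nat \<Rightarrow> nat. strict_mono s \<and> (AE \<omega> in M. (\<lambda>n. (F (s n) \<omega> - J \<omega>)\<^sup>2) \<longlonglongrightarrow> 0)"
    using to0 by (intro tendsto_L1_AE_subseq L2_fun_integrable_square L2_fun_diff L2) simp
  then obtain s :: "nat \<Rightarrow> nat" where s: "AE \<omega> in M. (\<lambda>n. (F (s n) \<omega> - J \<omega>)\<^sup>2) \<longlonglongrightarrow> 0" by blast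
  have "(\<integral>\<^sup>+\<omega>. ennreal (exp (\<theta> * J \<omega>)) \<partial>M) = (\<integral>\<^sup>+\<omega>. liminf (\<lambda>n. ennreal (exp (\<theta> * F (s n) \<omega>))) \<partial>M)"
  proof (rule nn_integral_cong_AE)
    from s show "AE \<omega> in M. ennreal (exp (\<theta> * J \<omega>)) = liminf (\<lambda>n. ennreal (exp (\<theta> * F (s n) \<omega>)))"
    proof eventually_elim
      case (elim \<omega>)
      from tendsto_real_sqrt[OF elim] have "(\<lambda>n. F (s n) \<omega> - J \<omega>) \<longlonglongrightarrow> 0"
        by (simp add: tendsto_rabs_zero_iff)
      then have "(\<lambda>n. F (s n) \<omega>) \<longlonglongrightarrow> J \<omega>" by (simp add: LIM_zero_iff)
      then have "(\<lambda>n. ennreal (exp (\<theta> * F (s n) \<omega>))) \<longlonglongrightarrow> ennreal (exp (\<theta> * J \<omega>))"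
        by (intro tendsto_intros)
      then show ?case by (rule lim_imp_Liminf[OF sequentially_bot, symmetric])
    qed
  qed
  also have "\<dots> \<le> liminf (\<lambda>n. \<integral>\<^sup>+\<omega>. ennreal (exp (\<theta> * F (s n) \<omega>)) \<partial>M)"
    by (rule nn_integral_liminf) measurable
  also have "\<dots> \<le> limsup (\<lambda>n. \<integral>\<^sup>+\<omega>. ennreal (exp (\<theta> * F (s n) \<omega>)) \<partial>M)"
    by (rule Liminf_le_Limsup) simp
  also have "\<dots> \<le> ennreal (exp (\<theta>\<^sup>2 * (\<Sum>k. (a k)\<^sup>2) / (2 * (1 - r))))"
    by (intro Limsup_bounded always_eventually allI partial)
  finally show ?thesis .
qed

lemma second_moment_tail:
  assumes "X \<in> L2_fun M" "0 < K"
  shows "prob {\<omega> \<in> space M. K \<le> \<bar>X \<omega>\<bar>} \<le> (LINT \<omega>|M. (X \<omega>)\<^sup>2) / K\<^sup>2"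
proof -
  have "prob {\<omega> \<in> space M. K\<^sup>2 \<le> (X \<omega>)\<^sup>2} \<le> (LINT \<omega>|M. (X \<omega>)\<^sup>2) / K\<^sup>2"
    using assms by (intro integral_Markov_inequality_measure[where A = "space M"] L2_fun_integrable_square) auto
  moreover have "K\<^sup>2 \<le> (X \<omega>)\<^sup>2 \<longleftrightarrow> K \<le> \<bar>X \<omega>\<bar>" for \<omega>
    using assms(2) abs_le_square_iff[of K "X \<omega>"] by simp
  ultimately show ?thesis by simp
qed

text \<open>The event that the term of index \<open>k\<close> is large while the remainder stays bounded by \<open>2 * K\<close>
  decides the tail; independence of the two is only used for the partial sums.\<close>

lemma gaussian_chaos_tail_lower:
  fixes W :: "nat \<Rightarrow> 'a \<Rightarrow> real"
  assumes indep: "\<And>N. indep_vars (\<lambda>_. borel) W {..<N}"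
    and distr: "\<And>k. distr M borel (W k) = std_normal_distribution"
    and lim: "L2_tendsto M (\<lambda>N \<omega>. 1 / 2 * (\<Sum>k<N. a k * ((W k \<omega>)\<^sup>2 - 1))) J"
    and "a k \<noteq> 0"
  shows "\<exists>C>0. \<forall>x\<ge>0. std_normal_density (sqrt (2 * (x + C) / \<bar>a k\<bar> + 1) + 1) / 2
    \<le> prob {\<omega> \<in> space M. x \<le> \<bar>J \<omega>\<bar>}"
proof -
  define F where "F N \<omega> = 1 / 2 * (\<Sum>k<N. a k * ((W k \<omega>)\<^sup>2 - 1))" for N \<omega>
  define T where "T j \<omega> = a j / 2 * ((W j \<omega>)\<^sup>2 - 1)" for j \<omega>
  have F_T: "F N \<omega> = (\<Sum>j<N. T j \<omega>)" for N \<omega>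
    by (simp add: F_def T_def sum_distrib_left)
  have limF: "L2_tendsto M F J" using lim unfolding F_def[abs_def] .
  then have L2: "F N \<in> L2_fun M" "J \<in> L2_fun M" for N
    unfolding L2_tendsto_def by auto
  \<comment> \<open>As the difference of consecutive partial sums, \<open>T k\<close> is square
    integrable without computing a fourth moment.\<close>
  have "(\<lambda>\<omega>. F (Suc k) \<omega> - F k \<omega>) \<in> L2_fun M" by (intro L2_fun_diff L2)
  then have T_L2: "T k \<in> L2_fun M" by (simp add: F_T)
  \<comment> \<open>For \<open>N > k\<close> this is the partial sum with the term of index
    \<open>k\<close> removed; \<open>R\<close> is the corresponding remainder of
    \<open>J\<close>.\<close>
  define G where "G N \<omega> = F N \<omega> - T k \<omega>" for N \<omega>
  define R where "R \<omega> = J \<omega> - T k \<omega>" for \<omega>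
  have limG: "L2_tendsto M G R"
    using L2_tendsto_add[OF limF L2_tendsto_const[OF L2_fun_cmult[OF T_L2, of "-1"]]]
    by (simp add: G_def[abs_def] R_def[abs_def])
  then have G_L2: "G N \<in> L2_fun M" and R_L2: "R \<in> L2_fun M"
    and G_lim: "(\<lambda>N. LINT \<omega>|M. (G N \<omega> - R \<omega>)\<^sup>2) \<longlonglongrightarrow> 0" for N
    by (auto simp: L2_tendsto_def)
  have [measurable]: "J \<in> borel_measurable M" "G N \<in> borel_measurable M" "R \<in> borel_measurable M"
      "T k \<in> borel_measurable M" for N
    using L2(2) G_L2 R_L2 T_L2 by (auto simp: L2_fun_def)
  have [measurable]: "W j \<in> borel_measurable M" for j
    using indep[of "Suc j"] by (auto simp: indep_vars_def2)
  define v where "v = (LINT \<omega>|M. (R \<omega>)\<^sup>2)"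
  have "v \<ge> 0" by (simp add: v_def)
  \<comment> \<open>Chosen so that a second moment below \<open>v + 1\<close> gives, by Chebyshev,
    probability at most 1/2 of exceeding \<open>K\<close>.\<close>
  define K where "K = sqrt (2 * (v + 1))"
  have K: "K > 0" "K\<^sup>2 = 2 * (v + 1)" using \<open>v \<ge> 0\<close> by (auto simp: K_def)
  have "std_normal_density (sqrt (2 * (x + 2 * K) / \<bar>a k\<bar> + 1) + 1) / 2
    \<le> prob {\<omega> \<in> space M. x \<le> \<bar>J \<omega>\<bar>}" if "x \<ge> 0" for x
  proof -
    \<comment> \<open>One \<open>K\<close> allows for the size of \<open>G N\<close>, the other for
      its distance from \<open>R\<close>.\<close>
    define y where "y = x + 2 * K"
    \<comment> \<open>The threshold at which \<open>W k \<ge> t\<close> forces the term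
      \<open>T k\<close> to reach \<open>y\<close> in absolute value.\<close>
    define t where "t = sqrt (2 * y / \<bar>a k\<bar> + 1)"
    have "y \<ge> 0" using that K by (simp add: y_def)
    then have t: "t \<ge> 0" "t\<^sup>2 = 2 * y / \<bar>a k\<bar> + 1" by (auto simp: t_def)
    define P where "P = prob {\<omega> \<in> space M. y \<le> \<bar>T k \<omega>\<bar>}"
    have "std_normal_density (t + 1) \<le> measure (distr M borel (W k)) {t..}"
      unfolding distr by (rule std_normal_tail_lower[OF t(1)])
    also have "\<dots> = prob (W k -` {t..} \<inter> space M)"
      by (rule measure_distr) auto
    also have "\<dots> \<le> P"
      unfolding P_def
    proof (rule finite_measure_mono)
      show "W k -` {t..} \<inter> space M \<subseteq> {\<omega> \<in> space M. y \<le> \<bar>T k \<omega>\<bar>}"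
      proof safe
        fix \<omega> assume "W k \<omega> \<ge> t"
        with t have "2 * y / \<bar>a k\<bar> + 1 \<le> (W k \<omega>)\<^sup>2" using power_mono[of t "W k \<omega>" 2] by simp
        then have "y \<le> \<bar>a k\<bar> / 2 * ((W k \<omega>)\<^sup>2 - 1)" using assms(4) by (simp add: field_simps)
        also have "\<dots> \<le> \<bar>a k\<bar> / 2 * \<bar>(W k \<omega>)\<^sup>2 - 1\<bar>" by (intro mult_left_mono) auto
        also have "\<dots> = \<bar>T k \<omega>\<bar>" by (simp add: T_def abs_mult)
        finally show "y \<le> \<bar>T k \<omega>\<bar>" .
      qed
    qed measurable
    finally have P: "std_normal_density (t + 1) \<le> P" .
    \<comment> \<open>Independence of \<open>T k\<close> and \<open>G N\<close> gives the factor
      1/2; the subtracted error is the price of replacing \<open>G N\<close> by \<open>R\<close> and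
      vanishes as \<open>N\<close> grows.\<close>
    have step: "P / 2 - (LINT \<omega>|M. (G N \<omega> - R \<omega>)\<^sup>2) / K\<^sup>2 \<le> prob {\<omega> \<in> space M. x \<le> \<bar>J \<omega>\<bar>}"
      if N: "N > k" "(LINT \<omega>|M. (G N \<omega>)\<^sup>2) < v + 1" for N
    proof -
      have "indep_vars (\<lambda>_. borel) T {..<N}"
        using indep_vars_compose2[OF indep, where N = "\<lambda>_. borel" and Y = "\<lambda>j x. a j / 2 * (x\<^sup>2 - 1)"]
        by (simp add: T_def[abs_def])
      moreover have "insert k ({..<N} - {k}) = {..<N}" using N by auto
      ultimately have "indep_var borel (T k) borel (\<lambda>\<omega>. \<Sum>j\<in>{..<N} - {k}. T j \<omega>)"
        by (intro indep_vars_sum) auto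
      moreover have "(\<lambda>\<omega>. \<Sum>j\<in>{..<N} - {k}. T j \<omega>) = G N"
        unfolding G_def[abs_def] F_T using N by (subst sum_diff1) auto
      ultimately have ind: "indep_var borel (T k) borel (G N)" by simp
      have "prob ((\<lambda>\<omega>. (T k \<omega>, G N \<omega>)) -` ({s. y \<le> \<bar>s\<bar>} \<times> {s. \<bar>s\<bar> < K}) \<inter> space M)
          = prob (T k -` {s. y \<le> \<bar>s\<bar>} \<inter> space M) * prob (G N -` {s. \<bar>s\<bar> < K} \<inter> space M)"
        by (rule indep_varD[OF ind]) measurable
      moreover have "(\<lambda>\<omega>. (T k \<omega>, G N \<omega>)) -` ({s. y \<le> \<bar>s\<bar>} \<times> {s. \<bar>s\<bar> < K}) \<inter> space M
          = {\<omega> \<in> space M. y \<le> \<bar>T k \<omega>\<bar> \<and> \<bar>G N \<omega>\<bar> < K}"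
        "T k -` {s. y \<le> \<bar>s\<bar>} \<inter> space M = {\<omega> \<in> space M. y \<le> \<bar>T k \<omega>\<bar>}"
        "G N -` {s. \<bar>s\<bar> < K} \<inter> space M = space M - {\<omega> \<in> space M. K \<le> \<bar>G N \<omega>\<bar>}"
        by auto
      ultimately have "prob {\<omega> \<in> space M. y \<le> \<bar>T k \<omega>\<bar> \<and> \<bar>G N \<omega>\<bar> < K}
          = P * (1 - prob {\<omega> \<in> space M. K \<le> \<bar>G N \<omega>\<bar>})"
        by (simp add: P_def prob_compl)
      moreover have "prob {\<omega> \<in> space M. K \<le> \<bar>G N \<omega>\<bar>} \<le> 1 / 2"
      proof -
        have "prob {\<omega> \<in> space M. K \<le> \<bar>G N \<omega>\<bar>} \<le> (LINT \<omega>|M. (G N \<omega>)\<^sup>2) / K\<^sup>2"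
          by (rule second_moment_tail[OF G_L2 K(1)])
        also have "\<dots> \<le> (v + 1) / K\<^sup>2" using N(2) by (intro divide_right_mono) auto
        also have "\<dots> = 1 / 2" using K(2) \<open>v \<ge> 0\<close> by simp
        finally show ?thesis .
      qed
      then have "P * (1 / 2) \<le> P * (1 - prob {\<omega> \<in> space M. K \<le> \<bar>G N \<omega>\<bar>})"
        by (intro mult_left_mono) (auto simp: P_def)
      \<comment> \<open>If \<open>G N\<close> is smaller than \<open>K\<close> and within
        \<open>K\<close> of \<open>R\<close>, then \<open>R\<close> is below \<open>2 * K\<close> in
        absolute value, and \<open>J = T k + R\<close> still reaches
        \<open>y - 2 * K = x\<close>.\<close>
      moreover have "prob {\<omega> \<in> space M. y \<le> \<bar>T k \<omega>\<bar> \<and> \<bar>G N \<omega>\<bar> < K}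
          \<le> prob ({\<omega> \<in> space M. x \<le> \<bar>J \<omega>\<bar>} \<union> {\<omega> \<in> space M. K \<le> \<bar>G N \<omega> - R \<omega>\<bar>})"
        by (rule finite_measure_mono) (auto simp: R_def y_def)
      moreover have "\<dots> \<le> prob {\<omega> \<in> space M. x \<le> \<bar>J \<omega>\<bar>} + prob {\<omega> \<in> space M. K \<le> \<bar>G N \<omega> - R \<omega>\<bar>}"
        by (rule measure_Un_le) measurable
      moreover have "prob {\<omega> \<in> space M. K \<le> \<bar>G N \<omega> - R \<omega>\<bar>} \<le> (LINT \<omega>|M. (G N \<omega> - R \<omega>)\<^sup>2) / K\<^sup>2"
        by (rule second_moment_tail[OF L2_fun_diff[OF G_L2 R_L2] K(1)])
      ultimately show ?thesis by linarith
    qed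
    have "P / 2 - 0 / K\<^sup>2 \<le> prob {\<omega> \<in> space M. x \<le> \<bar>J \<omega>\<bar>}"
    proof (rule tendsto_upperbound)
      show "(\<lambda>N. P / 2 - (LINT \<omega>|M. (G N \<omega> - R \<omega>)\<^sup>2) / K\<^sup>2) \<longlonglongrightarrow> P / 2 - 0 / K\<^sup>2"
        using K by (intro tendsto_intros G_lim) auto
      have "\<forall>\<^sub>F N in sequentially. (LINT \<omega>|M. (G N \<omega>)\<^sup>2) < v + 1"
        using L2_tendsto_square_integral[OF limG] by (rule order_tendstoD) (simp add: v_def)
      then show "\<forall>\<^sub>F N in sequentially. P / 2 - (LINT \<omega>|M. (G N \<omega> - R \<omega>)\<^sup>2) / K\<^sup>2
          \<le> prob {\<omega> \<in> space M. x \<le> \<bar>J \<omega>\<bar>}"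
        using eventually_gt_at_top[of k] by eventually_elim (rule step)
    qed simp
    with P show ?thesis by (simp add: t_def y_def)
  qed
  with K(1) show ?thesis by (intro exI[of _ "2 * K"]) simp
qed

end

section \<open>Tails of the norm\<close>

text \<open>Sandwiching the norm between one coordinate and the l^1 norm removes \<open>p\<close>
  from the tail asymptotics.\<close>

lemma lp_norm_bounds:
  assumes I: "finite I" "i \<in> I" and p: "1 \<le> p"
  shows "\<bar>v i\<bar> \<le> lp_norm p I v" and "lp_norm p I v \<le> (\<Sum>j\<in>I. \<bar>v j\<bar>)"
proof -
  define S where "S = (\<Sum>j\<in>I. \<bar>v j\<bar>)"
  have le_S: "\<bar>v j\<bar> \<le> S" if "j \<in> I" for j
    unfolding S_def using I(1) that by (intro member_le_sum) auto
  have "\<bar>v i\<bar> \<le> lp_norm p I v \<and> lp_norm p I v \<le> S"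
  proof (cases "p = \<infinity>")
    case True
    moreover have "\<bar>v i\<bar> \<le> Max ((\<lambda>i. \<bar>v i\<bar>) ` I)" using I by (intro Max_ge) auto
    moreover have "Max ((\<lambda>i. \<bar>v i\<bar>) ` I) \<le> S" using I le_S by (intro Max.boundedI) auto
    ultimately show ?thesis by (simp add: lp_norm_def)
  next
    case False
    define q where "q = enn2real p"
    have q: "1 \<le> q"
      using p False enn2real_mono[of 1 p] by (simp add: q_def top.not_eq_extremum)
    have norm: "lp_norm p I v = (\<Sum>j\<in>I. \<bar>v j\<bar> powr q) powr (1 / q)"
      using False by (simp add: lp_norm_def q_def)
    have "\<bar>v i\<bar> = (\<bar>v i\<bar> powr q) powr (1 / q)"
      using q by (simp add: powr_powr)
    also have "\<dots> \<le> lp_norm p I v"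
      unfolding norm using I q by (intro powr_mono2 member_le_sum) auto
    finally have lower: "\<bar>v i\<bar> \<le> lp_norm p I v" .
    have "S \<ge> 0" by (simp add: S_def sum_nonneg)
    \<comment> \<open>Splitting off one factor and bounding the other \<open>q - 1\<close> powers by
      the sum \<open>S\<close> is where \<open>q \<ge> 1\<close> enters.\<close>
    have "(\<Sum>j\<in>I. \<bar>v j\<bar> powr q) \<le> (\<Sum>j\<in>I. \<bar>v j\<bar> * S powr (q - 1))"
    proof (rule sum_mono)
      fix j assume "j \<in> I"
      have "\<bar>v j\<bar> powr q = \<bar>v j\<bar> * \<bar>v j\<bar> powr (q - 1)"
        using powr_mult_base[of "\<bar>v j\<bar>" "q - 1"] by simp
      also have "\<dots> \<le> \<bar>v j\<bar> * S powr (q - 1)"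
        using le_S[OF \<open>j \<in> I\<close>] q by (intro mult_left_mono powr_mono2) auto
      finally show "\<bar>v j\<bar> powr q \<le> \<bar>v j\<bar> * S powr (q - 1)" .
    qed
    also have "\<dots> = S * S powr (q - 1)" by (simp add: S_def sum_distrib_right)
    also have "\<dots> = S powr q"
      using powr_mult_base[of S "q - 1"] \<open>S \<ge> 0\<close> by simp
    finally have "lp_norm p I v \<le> (S powr q) powr (1 / q)"
      unfolding norm using q by (intro powr_mono2 sum_nonneg) auto
    also have "\<dots> = S" using q \<open>S \<ge> 0\<close> by (simp add: powr_powr)
    finally show ?thesis using lower by simp
  qed
  then show "\<bar>v i\<bar> \<le> lp_norm p I v" "lp_norm p I v \<le> (\<Sum>j\<in>I. \<bar>v j\<bar>)" by (auto simp: S_def)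
qed

lemma borel_measurable_lp_norm:
  assumes "finite I" "\<And>i. i \<in> I \<Longrightarrow> J i \<in> borel_measurable M"
  shows "(\<lambda>\<omega>. lp_norm p I (\<lambda>i. J i \<omega>)) \<in> borel_measurable M"
proof (cases "p = \<infinity>")
  case True
  then show ?thesis unfolding lp_norm_def using assms
    by (auto intro!: borel_measurable_Max)
next
  case False
  have "(\<lambda>\<omega>. (\<Sum>i\<in>I. \<bar>J i \<omega>\<bar> powr enn2real p) powr (1 / enn2real p)) \<in> borel_measurable M"
    using assms
    by (intro powr_real_measurable borel_measurable_sum borel_measurable_abs borel_measurable_const) auto
  then show ?thesis using False by (simp add: lp_norm_def)
qed

text \<open>Square summable eigenvalues tend to 0, so only finitely many reach the absolute value
  \<open>e\<close> of a given nonzero one, and the maximum over these is the global one. Being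
  attained, it is the value of \<open>GREATEST\<close>.\<close>

lemma square_summable_family_max:
  fixes a :: "'i \<Rightarrow> nat \<Rightarrow> real"
  assumes "finite I" and sq: "\<And>i. i \<in> I \<Longrightarrow> summable (\<lambda>k. (a i k)\<^sup>2)"
    and "i0 \<in> I" "a i0 k0 \<noteq> 0"
  shows "\<exists>i\<in>I. \<exists>k. a i k \<noteq> 0 \<and> (\<forall>j\<in>I. \<forall>l. \<bar>a j l\<bar> \<le> \<bar>a i k\<bar>) \<and>
    (GREATEST r. \<exists>i\<in>I. \<exists>k. r = \<bar>a i k\<bar>) = \<bar>a i k\<bar>"
proof -
  define e where "e = \<bar>a i0 k0\<bar>"
  have "e > 0" using assms by (simp add: e_def)
  define S where "S = (SIGMA i:I. {k. e \<le> \<bar>a i k\<bar>})"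
  have "finite {k. e \<le> \<bar>a i k\<bar>}" if "i \<in> I" for i
  proof -
    have "(\<lambda>k. (a i k)\<^sup>2) \<longlonglongrightarrow> 0" using sq[OF that] by (rule summable_LIMSEQ_zero)
    from order_tendstoD(2)[OF this, of "e\<^sup>2"] have "\<forall>\<^sub>F k in sequentially. (a i k)\<^sup>2 < e\<^sup>2"
      using \<open>e > 0\<close> by simp
    then have "\<forall>\<^sub>F k in sequentially. \<not> e \<le> \<bar>a i k\<bar>"
    proof eventually_elim
      case (elim k)
      then show ?case using \<open>e > 0\<close> abs_le_square_iff[of e "a i k"] by auto
    qed
    then show ?thesis by (simp add: cofinite_eq_sequentially[symmetric] eventually_cofinite)
  qed
  then have fin: "finite S" using assms(1) by (auto simp: S_def)
  have ne: "(i0, k0) \<in> S" using assms by (simp add: S_def e_def)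
  define m where "m = Max ((\<lambda>(i, k). \<bar>a i k\<bar>) ` S)"
  have "m \<in> (\<lambda>(i, k). \<bar>a i k\<bar>) ` S" unfolding m_def using fin ne by (intro Max_in) auto
  then obtain i k where ik: "(i, k) \<in> S" "m = \<bar>a i k\<bar>" by auto
  have le: "\<bar>a j l\<bar> \<le> \<bar>a i k\<bar>" if "j \<in> I" for j l
  proof (cases "e \<le> \<bar>a j l\<bar>")
    case True
    then have "(j, l) \<in> S" using that by (simp add: S_def)
    then have "\<bar>a j l\<bar> \<le> m" unfolding m_def using fin by (intro Max_ge) force+
    then show ?thesis using ik by simp
  next
    case False
    then show ?thesis using ik(1) by (simp add: S_def)
  qed
  have "i \<in> I" "a i k \<noteq> 0" using ik(1) \<open>e > 0\<close> by (auto simp: S_def)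
  moreover have "(GREATEST r. \<exists>i\<in>I. \<exists>k. r = \<bar>a i k\<bar>) = \<bar>a i k\<bar>"
    using \<open>i \<in> I\<close> le by (intro Greatest_equality) auto
  ultimately show ?thesis using le by blast
qed

text \<open>The interface to the Gaussian estimates: kernel, basis and Brownian motion are replaced
  by a series in independent standard normal variables.\<close>

lemma quadratic_wiener_functional_gaussian_chaos:
  assumes "is_quadratic_wiener_functional M B f a h J"
  shows "\<exists>W. (\<forall>N::nat. prob_space.indep_vars M (\<lambda>_. borel) W {..<N}) \<and>
    (\<forall>k. distr M borel (W k) = std_normal_distribution) \<and> summable (\<lambda>k. (a k)\<^sup>2) \<and>
    L2_tendsto M (\<lambda>N \<omega>. 1 / 2 * (\<Sum>k<N. a k * ((W k \<omega>)\<^sup>2 - 1))) J"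
proof -
  from assms interpret brownian_motion M B
    by (simp add: is_quadratic_wiener_functional_def)
  from assms obtain W where "L2_orthonormal_basis half_line h" "\<And>k. is_wiener_integral M B (h k) (W k)"
    "summable (\<lambda>k. (a k)\<^sup>2)" "L2_tendsto M (\<lambda>N \<omega>. 1 / 2 * (\<Sum>k<N. a k * ((W k \<omega>)\<^sup>2 - 1))) J"
    unfolding is_quadratic_wiener_functional_def eigen_expansion_def by blast
  then show ?thesis
    by (intro exI[of _ W] conjI allI indep_vars_wiener_integrals[of h] distr_wiener_integral[of h]) auto
qed

text \<open>If all eigenvalues were 0, every partial sum would vanish and so would their L^2 limit.
  This makes the largest absolute eigenvalue positive.\<close>

lemma quadratic_wiener_functional_nonzero_eigenvalue:
  assumes "is_quadratic_wiener_functional M B f a h J" "\<not> (AE \<omega> in M. J \<omega> = 0)"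
  obtains k where "a k \<noteq> 0"
proof (cases "\<exists>k. a k \<noteq> 0")
  case False
  obtain W where "L2_tendsto M (\<lambda>N \<omega>. 1 / 2 * (\<Sum>k<N. a k * ((W k \<omega>)\<^sup>2 - 1))) J"
    using quadratic_wiener_functional_gaussian_chaos[OF assms(1)] by blast
  with False have "L2_tendsto M (\<lambda>N \<omega>. 0) J" by simp
  then have J: "J \<in> L2_fun M" and "(\<lambda>N::nat. LINT \<omega>|M. (J \<omega>)\<^sup>2) \<longlonglongrightarrow> 0"
    by (auto simp: L2_tendsto_def)
  then have "(LINT \<omega>|M. (J \<omega>)\<^sup>2) = 0" by (simp add: LIMSEQ_const_iff)
  then have "AE \<omega> in M. (J \<omega>)\<^sup>2 = 0"
    using integral_nonneg_eq_0_iff_AE[OF L2_fun_integrable_square[OF J]] by simp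
  with assms(2) show ?thesis by simp
qed (use that in blast)

text \<open>The exponential of an absolute value is at most the sum of the two one-sided
  exponentials, each finite by the moment bound with parameter \<open>\<theta>\<close> or
  \<open>- \<theta>\<close>.\<close>

lemma quadratic_wiener_functional_exp_abs_finite:
  assumes J: "is_quadratic_wiener_functional M B f a h J" and "0 \<le> \<theta>"
    and r: "\<And>k. \<theta> * \<bar>a k\<bar> \<le> r" "r < 1"
  shows "(\<integral>\<^sup>+\<omega>. ennreal (exp (\<theta> * \<bar>J \<omega>\<bar>)) \<partial>M) < \<infinity>"
proof -
  from J interpret brownian_motion M B
    by (simp add: is_quadratic_wiener_functional_def)
  obtain W where W: "\<And>N. indep_vars (\<lambda>_. borel) W {..<N::nat}"
    "\<And>k. distr M borel (W k) = std_normal_distribution"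
    "summable (\<lambda>k. (a k)\<^sup>2)"
    "L2_tendsto M (\<lambda>N \<omega>. 1 / 2 * (\<Sum>k<N. a k * ((W k \<omega>)\<^sup>2 - 1))) J"
    using quadratic_wiener_functional_gaussian_chaos[OF J] by blast
  have [measurable]: "J \<in> borel_measurable M" using W(4) by (simp add: L2_tendsto_def L2_fun_def)
  have "\<theta> * a k \<le> r \<and> - \<theta> * a k \<le> r" for k
    using r(1)[of k] mult_left_mono[OF abs_ge_self[of "a k"] \<open>0 \<le> \<theta>\<close>]
      mult_left_mono[OF abs_ge_minus_self[of "a k"] \<open>0 \<le> \<theta>\<close>] by simp
  then have r': "\<theta> * a k \<le> r" "- \<theta> * a k \<le> r" for k by auto
  have "(\<integral>\<^sup>+\<omega>. ennreal (exp (\<theta> * \<bar>J \<omega>\<bar>)) \<partial>M)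
      \<le> (\<integral>\<^sup>+\<omega>. ennreal (exp (\<theta> * J \<omega>)) + ennreal (exp (- \<theta> * J \<omega>)) \<partial>M)"
    by (intro nn_integral_mono) (auto simp: abs_if)
  also have "\<dots> = (\<integral>\<^sup>+\<omega>. ennreal (exp (\<theta> * J \<omega>)) \<partial>M) + (\<integral>\<^sup>+\<omega>. ennreal (exp (- \<theta> * J \<omega>)) \<partial>M)"
    by (rule nn_integral_add) auto
  also have "\<dots> < \<infinity>"
    using gaussian_chaos_mgf_bound[OF W r'(1) r(2)] gaussian_chaos_mgf_bound[OF W r'(2) r(2)]
    by (auto simp: le_less_trans)
  finally show ?thesis .
qed

lemma quadratic_wiener_functional_tail_lower:
  assumes J: "is_quadratic_wiener_functional M B f a h J" and "a k \<noteq> 0"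
  shows "\<exists>C>0. \<forall>x\<ge>0. std_normal_density (sqrt (2 * (x + C) / \<bar>a k\<bar> + 1) + 1) / 2
    \<le> measure M {\<omega> \<in> space M. x \<le> \<bar>J \<omega>\<bar>}"
proof -
  from J interpret brownian_motion M B
    by (simp add: is_quadratic_wiener_functional_def)
  obtain W where "\<And>N. indep_vars (\<lambda>_. borel) W {..<N::nat}"
    "\<And>k. distr M borel (W k) = std_normal_distribution"
    "L2_tendsto M (\<lambda>N \<omega>. 1 / 2 * (\<Sum>k<N. a k * ((W k \<omega>)\<^sup>2 - 1))) J"
    using quadratic_wiener_functional_gaussian_chaos[OF J] by blast
  from gaussian_chaos_tail_lower[OF this assms(2)] show ?thesis .
qed

text \<open>Independence makes the exponential moment of the sum a product of finite ones at the
  same \<open>\<theta>\<close>, so adding functionals changes only the constant in Chernoff's bound,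
  not the rate.\<close>

lemma (in prob_space) indep_sum_abs_tail_upper:
  fixes J :: "'i \<Rightarrow> 'a \<Rightarrow> real"
  assumes I: "finite I" and indep: "indep_vars (\<lambda>_. borel) J I" and "0 < \<theta>"
    and fin: "\<And>i. i \<in> I \<Longrightarrow> (\<integral>\<^sup>+\<omega>. ennreal (exp (\<theta> * \<bar>J i \<omega>\<bar>)) \<partial>M) < \<infinity>"
  shows "\<exists>D>0. \<forall>x. prob {\<omega> \<in> space M. x \<le> (\<Sum>i\<in>I. \<bar>J i \<omega>\<bar>)} \<le> D * exp (- \<theta> * x)"
proof -
  have rv: "J i \<in> borel_measurable M" if "i \<in> I" for i
    using indep that by (auto simp: indep_vars_def2)
  define S where "S \<omega> = (\<Sum>i\<in>I. \<bar>J i \<omega>\<bar>)" for \<omega>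
  have [measurable]: "S \<in> borel_measurable M"
    unfolding S_def[abs_def] using rv by (intro borel_measurable_sum borel_measurable_abs) auto
  define E where "E = (\<integral>\<^sup>+\<omega>. ennreal (exp (\<theta> * S \<omega>)) \<partial>M)"
  have "E = (\<integral>\<^sup>+\<omega>. (\<Prod>i\<in>I. ennreal (exp (\<theta> * \<bar>J i \<omega>\<bar>))) \<partial>M)"
    unfolding E_def S_def using I by (simp add: sum_distrib_left exp_sum prod_ennreal)
  also have "\<dots> = (\<Prod>i\<in>I. \<integral>\<^sup>+\<omega>. ennreal (exp (\<theta> * \<bar>J i \<omega>\<bar>)) \<partial>M)"
    by (intro indep_vars_nn_integral I
        indep_vars_compose2[OF indep, where Y = "\<lambda>_ x. ennreal (exp (\<theta> * \<bar>x\<bar>))"]) auto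
  also have "\<dots> < \<infinity>"
    using fin unfolding infinity_ennreal_def less_top[symmetric] ennreal_prod_eq_top by blast
  finally have "E < \<infinity>" .
  \<comment> \<open>Adding 1 keeps the constant positive, so that its logarithm can be used
    later.\<close>
  define D where "D = enn2real E + 1"
  have D: "D > 0" "E \<le> ennreal D"
    using \<open>E < \<infinity>\<close> unfolding D_def by (auto simp: ennreal_enn2real_if less_top add_nonneg_pos)
  have "prob {\<omega> \<in> space M. x \<le> S \<omega>} \<le> D * exp (- \<theta> * x)" for x
  proof -
    have "emeasure M {\<omega> \<in> space M. x \<le> S \<omega>}
        \<le> ennreal (exp (- \<theta> * x)) * (\<integral>\<^sup>+\<omega>. ennreal (exp (\<theta> * S \<omega>)) * indicator (space M) \<omega> \<partial>M)"
      using \<open>0 < \<theta>\<close> by (intro Chernoff_ineq_nn_integral_ge) auto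
    also have "(\<integral>\<^sup>+\<omega>. ennreal (exp (\<theta> * S \<omega>)) * indicator (space M) \<omega> \<partial>M) = E"
      unfolding E_def by (intro nn_integral_cong) auto
    also have "ennreal (exp (- \<theta> * x)) * E \<le> ennreal (exp (- \<theta> * x)) * ennreal D"
      using D by (intro mult_left_mono) auto
    also have "\<dots> = ennreal (D * exp (- \<theta> * x))"
      using D by (simp add: mult.commute flip: ennreal_mult')
    finally show ?thesis using D unfolding emeasure_eq_measure by (simp add: ennreal_le_iff)
  qed
  with D(1) show ?thesis unfolding S_def by blast
qed

text \<open>The remaining limit is deterministic: values below \<open>- 1 / \<alpha>\<close> are
  excluded by the Gaussian lower bound, values above it by an exponential bound with
  \<open>\<theta>\<close> close enough to \<open>1 / \<alpha>\<close>.\<close>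

lemma log_tail_rate:
  fixes q :: "real \<Rightarrow> real"
  assumes "0 < \<alpha>" "0 < C"
    and lower: "\<And>x. 0 \<le> x \<Longrightarrow> std_normal_density (sqrt (2 * (x + C) / \<alpha> + 1) + 1) / 2 \<le> q x"
    and upper: "\<And>\<theta>. 0 < \<theta> \<Longrightarrow> \<theta> < 1 / \<alpha> \<Longrightarrow> \<exists>D>0. \<forall>x. q x \<le> D * exp (- \<theta> * x)"
  shows "((\<lambda>x. ln (q x) / x) \<longlongrightarrow> - 1 / \<alpha>) at_top"
proof (rule order_tendstoI)
  have q_pos: "0 < q x" if "0 \<le> x" for x
    using lower[OF that] by (rule less_le_trans[rotated]) (simp add: normal_density_pos)
  fix y :: real
  {
    assume y: "y < - 1 / \<alpha>"
    define l where "l x = (- ln (sqrt (2 * pi)) - (sqrt (2 * (x + C) / \<alpha> + 1) + 1)\<^sup>2 / 2 - ln 2) / x" for x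
    have "(l \<longlongrightarrow> - 1 / \<alpha>) at_top"
    proof -
      \<comment> \<open>Half the expanded square is \<open>x / \<alpha>\<close> up to terms of order
        sqrt x, which disappear after division by \<open>x\<close>. The limit is first found as a
        power and then simplified.\<close>
      have "(l \<longlongrightarrow> - ((2 * inverse \<alpha>) powr (1 / 2))\<^sup>2 / 2) at_top"
        unfolding l_def using assms(1,2) by real_asymp
      moreover have "(2 * inverse \<alpha>) powr (1 / 2) = sqrt (2 * inverse \<alpha>)"
        using assms(1) by (intro powr_half_sqrt) simp
      moreover have "(sqrt (2 * inverse \<alpha>))\<^sup>2 = 2 * inverse \<alpha>"
        using assms(1) by (intro real_sqrt_pow2) simp
      moreover have "- (2 * inverse \<alpha>) / 2 = - 1 / \<alpha>" using assms(1) by (simp add: field_simps)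
      ultimately show ?thesis by (simp only:)
    qed
    from order_tendstoD(1)[OF this y] have "\<forall>\<^sub>F x in at_top. y < l x" .
    then show "\<forall>\<^sub>F x in at_top. y < ln (q x) / x"
      using eventually_gt_at_top[of 0]
    proof eventually_elim
      case (elim x)
      have "ln (std_normal_density (sqrt (2 * (x + C) / \<alpha> + 1) + 1) / 2) \<le> ln (q x)"
        using lower[of x] elim normal_density_pos[of 1 0] by (intro ln_mono) auto
      moreover have "ln (std_normal_density s / 2) = - ln (sqrt (2 * pi)) - s\<^sup>2 / 2 - ln 2" for s
        unfolding std_normal_density_def by (simp add: ln_div ln_mult)
      ultimately have "l x \<le> ln (q x) / x"
        unfolding l_def using elim by (simp add: divide_right_mono)
      with elim show ?case by simp
    qed
  next
    assume y: "- 1 / \<alpha> < y"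
    \<comment> \<open>The maximum with 0 keeps \<open>\<theta>\<close> positive even when
      \<open>y\<close> is positive, and \<open>\<theta> > - y\<close> puts the limit
      \<open>- \<theta>\<close> below \<open>y\<close>.\<close>
    have "max 0 (- y) < 1 / \<alpha>" using y assms(1) by simp
    then obtain \<theta> where \<theta>: "max 0 (- y) < \<theta>" "\<theta> < 1 / \<alpha>" using dense by blast
    then obtain D where D: "D > 0" "\<And>x. q x \<le> D * exp (- \<theta> * x)" using upper[of \<theta>] by auto
    have "((\<lambda>x. (ln D - \<theta> * x) / x) \<longlongrightarrow> - \<theta>) at_top" by real_asymp
    then have "\<forall>\<^sub>F x in at_top. (ln D - \<theta> * x) / x < y"
      using \<theta> by (intro order_tendstoD) auto
    then show "\<forall>\<^sub>F x in at_top. ln (q x) / x < y"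
      using eventually_gt_at_top[of 0]
    proof eventually_elim
      case (elim x)
      have "ln (q x) \<le> ln (D * exp (- \<theta> * x))"
        using D(2)[of x] q_pos[of x] elim by (intro ln_mono) auto
      also have "\<dots> = ln D - \<theta> * x" using D(1) by (simp add: ln_mult)
      finally have "ln (q x) / x \<le> (ln D - \<theta> * x) / x" using elim by (intro divide_right_mono) auto
      with elim show ?case by simp
    qed
  }
qed

theorem corollary4p5:
  fixes M :: "'a measure" and n :: nat and p :: ennreal
    and B :: "nat \<Rightarrow> real \<Rightarrow> 'a \<Rightarrow> real"
    and f :: "nat \<Rightarrow> real \<times> real \<Rightarrow> real"
    and a :: "nat \<Rightarrow> nat \<Rightarrow> real"
    and h :: "nat \<Rightarrow> nat \<Rightarrow> real \<Rightarrow> real"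
    and J :: "nat \<Rightarrow> 'a \<Rightarrow> real"
  assumes "prob_space M" and "1 \<le> n" and "1 \<le> p"
    and "\<And>i. i \<in> {1..n} \<Longrightarrow>
           is_quadratic_wiener_functional M (B i) (f i) (a i) (h i) (J i)"
    and "\<And>i. i \<in> {1..n} \<Longrightarrow> \<not> (AE \<omega> in M. J i \<omega> = 0)"
    and "prob_space.indep_vars M (\<lambda>_. borel) J {1..n}"
  shows "((\<lambda>x. ln (measure M {\<omega> \<in> space M. lp_norm p {1..n} (\<lambda>i. J i \<omega>) \<ge> x}) / x)
           \<longlongrightarrow> - 1 / (GREATEST r. \<exists>i\<in>{1..n}. \<exists>k. r = \<bar>a i k\<bar>)) at_top"
proof -
  interpret prob_space M by fact
  note J = assms(4)
  have rv: "J i \<in> borel_measurable M" if "i \<in> {1..n}" for i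
    using assms(6) that by (auto simp: indep_vars_def2)
  define q where "q x = prob {\<omega> \<in> space M. x \<le> lp_norm p {1..n} (\<lambda>i. J i \<omega>)}" for x
  have [measurable]: "(\<lambda>\<omega>. lp_norm p {1..n} (\<lambda>i. J i \<omega>)) \<in> borel_measurable M"
    using rv by (intro borel_measurable_lp_norm) auto
  have [measurable]: "(\<lambda>\<omega>. \<Sum>i\<in>{1..n}. \<bar>J i \<omega>\<bar>) \<in> borel_measurable M"
    using rv by (intro borel_measurable_sum borel_measurable_abs) auto
  have "1 \<in> {1..n}" using assms(2) by simp
  then obtain k0 where "a 1 k0 \<noteq> 0"
    using quadratic_wiener_functional_nonzero_eigenvalue[OF J assms(5)] by blast
  moreover have "summable (\<lambda>k. (a i k)\<^sup>2)" if "i \<in> {1..n}" for i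
    using quadratic_wiener_functional_gaussian_chaos[OF J[OF that]] by blast
  ultimately obtain i k where ik: "i \<in> {1..n}" "a i k \<noteq> 0"
    and max: "\<And>j l. j \<in> {1..n} \<Longrightarrow> \<bar>a j l\<bar> \<le> \<bar>a i k\<bar>"
    and greatest: "(GREATEST r. \<exists>i\<in>{1..n}. \<exists>k. r = \<bar>a i k\<bar>) = \<bar>a i k\<bar>"
    using square_summable_family_max[of "{1..n}" a 1 k0] \<open>1 \<in> {1..n}\<close> by blast
  from quadratic_wiener_functional_tail_lower[OF J[OF ik(1)], of k] ik(2)
  obtain C where C: "0 < C"
    "\<And>x. 0 \<le> x \<Longrightarrow> std_normal_density (sqrt (2 * (x + C) / \<bar>a i k\<bar> + 1) + 1) / 2
       \<le> prob {\<omega> \<in> space M. x \<le> \<bar>J i \<omega>\<bar>}" by blast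
  have "((\<lambda>x. ln (q x) / x) \<longlongrightarrow> - 1 / \<bar>a i k\<bar>) at_top"
  proof (rule log_tail_rate[OF _ C(1)])
    show "0 < \<bar>a i k\<bar>" using ik(2) by simp
  next
    fix x :: real assume "0 \<le> x"
    \<comment> \<open>Lower bound: the norm dominates the coordinate that carries the largest
      eigenvalue.\<close>
    note C(2)[OF this]
    also have "prob {\<omega> \<in> space M. x \<le> \<bar>J i \<omega>\<bar>} \<le> q x"
      unfolding q_def
    proof (rule finite_measure_mono)
      show "{\<omega> \<in> space M. x \<le> \<bar>J i \<omega>\<bar>} \<subseteq> {\<omega> \<in> space M. x \<le> lp_norm p {1..n} (\<lambda>i. J i \<omega>)}"
        by (safe, rule order_trans[OF _ lp_norm_bounds(1)[OF finite_atLeastAtMost ik(1) assms(3)]])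
    qed measurable
    finally show "std_normal_density (sqrt (2 * (x + C) / \<bar>a i k\<bar> + 1) + 1) / 2 \<le> q x" .
  next
    fix \<theta> :: real assume \<theta>: "0 < \<theta>" "\<theta> < 1 / \<bar>a i k\<bar>"
    have "\<exists>D>0. \<forall>x. prob {\<omega> \<in> space M. x \<le> (\<Sum>j\<in>{1..n}. \<bar>J j \<omega>\<bar>)} \<le> D * exp (- \<theta> * x)"
    proof (rule indep_sum_abs_tail_upper[OF _ assms(6) \<theta>(1)])
      fix j assume j: "j \<in> {1..n}"
      show "(\<integral>\<^sup>+\<omega>. ennreal (exp (\<theta> * \<bar>J j \<omega>\<bar>)) \<partial>M) < \<infinity>"
      \<comment> \<open>By maximality \<open>r = \<theta> * \<bar>a i k\<bar>\<close> works for all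
        coordinates and eigenvalues at once, and it is below 1 by the choice of
        \<open>\<theta>\<close>.\<close>
      proof (rule quadratic_wiener_functional_exp_abs_finite[OF J[OF j]])
        show "\<theta> * \<bar>a j l\<bar> \<le> \<theta> * \<bar>a i k\<bar>" for l
          using max[OF j] \<theta>(1) by (intro mult_left_mono) auto
        show "\<theta> * \<bar>a i k\<bar> < 1" using \<theta>(2) ik(2) by (simp add: field_simps)
      qed (use \<theta> in simp)
    qed simp
    moreover have "q x \<le> prob {\<omega> \<in> space M. x \<le> (\<Sum>j\<in>{1..n}. \<bar>J j \<omega>\<bar>)}" for x
      unfolding q_def
    proof (rule finite_measure_mono)
      show "{\<omega> \<in> space M. x \<le> lp_norm p {1..n} (\<lambda>i. J i \<omega>)}
          \<subseteq> {\<omega> \<in> space M. x \<le> (\<Sum>j\<in>{1..n}. \<bar>J j \<omega>\<bar>)}"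
        by (safe, rule order_trans[OF _ lp_norm_bounds(2)[OF finite_atLeastAtMost ik(1) assms(3)]])
    qed measurable
    ultimately show "\<exists>D>0. \<forall>x. q x \<le> D * exp (- \<theta> * x)"
      by (meson order_trans)
  qed
  then show ?thesis unfolding greatest q_def .
qed

end
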